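(* Let $\mathcal A$ be a von Neumann algebra. The Wasserstein mean $\sigma_w$ has the order determining property on $\mathcal A$ if and only if $\mathcal A$ is commutative.
   Context: $\mathcal A^{++}$ denotes the set of all positive invertible elements of $\mathcal A$. For $A,B\in\mathcal A^{++}$, $A\# B=A^{1/2}(A^{-1/2}BA^{-1/2})^{1/2}A^{1/2}$, and the Wasserstein mean is $A\,\sigma_w\,B=\frac14\bigl(A+B+A(A^{-1}\# B)+(A^{-1}\# B)A\bigr)$. A mean $\sigma$ on $\mathcal A^{++}$ is said to have the order determining property on $\mathcal A$ if for any $A,B\in\mathcal A^{++}$ one has: $A\le B$ if and only if $\|A\,\sigma\,X\|\le\|B\,\sigma\,X\|$ for all $X\in\mathcal A^{++}$. Here $\|\cdot\|$ is the $C^*$-norm and $\le$ is the usual order on self-adjoint elements. *)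

theory Defs
  imports "HOL-Analysis.Analysis"
begin

text \<open>
  Complex Hilbert spaces. The ambient real Hilbert space structure (norm, topology, real inner
  product, completeness) is that of the library; the complex inner product is conjugate-linear in
  its first argument, and the real inner product is its real part, so that
  \<open>norm x = sqrt (Re (cinner x x))\<close>. Definiteness of \<open>cinner\<close> is inherited from \<open>inner\<close>.
\<close>

class chilbert_space = real_inner + complete_space +
  fixes scaleC :: "complex \<Rightarrow> 'a \<Rightarrow> 'a" (infixr \<open>*\<^sub>C\<close> 75)
    and cinner :: "'a \<Rightarrow> 'a \<Rightarrow> complex"
  assumes scaleC_add_right: "a *\<^sub>C (x + y) = a *\<^sub>C x + a *\<^sub>C y"
    and scaleC_add_left: "(a + b) *\<^sub>C x = a *\<^sub>C x + b *\<^sub>C x"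
    and scaleC_scaleC: "a *\<^sub>C (b *\<^sub>C x) = (a * b) *\<^sub>C x"
    and scaleC_of_real: "complex_of_real r *\<^sub>C x = r *\<^sub>R x"
    and cinner_commute: "cinner x y = cnj (cinner y x)"
    and cinner_add_right: "cinner x (y + z) = cinner x y + cinner x z"
    and cinner_scaleC_right: "cinner x (a *\<^sub>C y) = a * cinner x y"
    and inner_eq_Re_cinner: "inner x y = Re (cinner x y)"
begin

subclass banach ..

end

lemma norm_scaleC: "norm (a *\<^sub>C x) = cmod a * norm (x :: 'h::chilbert_space)"
proof -
  have "cinner (a *\<^sub>C x) (a *\<^sub>C x) = a * cnj a * cnj (cinner x x)"
    by (metis cinner_commute cinner_scaleC_right complex_cnj_mult mult.assoc)
  also have "\<dots> = complex_of_real ((cmod a)\<^sup>2) * cnj (cinner x x)"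
    by (simp only: complex_norm_square)
  finally have "inner (a *\<^sub>C x) (a *\<^sub>C x) = (cmod a)\<^sup>2 * inner x x"
    by (simp add: inner_eq_Re_cinner)
  then show ?thesis
    by (simp add: norm_eq_sqrt_inner real_sqrt_mult)
qed

text \<open>
  The type \<open>'h \<Rightarrow>\<^sub>L 'h\<close> consists of the bounded \<^emph>\<open>real\<close>-linear operators; the bounded operators of
  the complex Hilbert space are those satisfying \<open>clinear_op\<close>. On these, the norm, the composition
  and the strong operator topology of the library are the usual ones.
\<close>

definition clinear_op :: "('h::chilbert_space \<Rightarrow>\<^sub>L 'h) \<Rightarrow> bool" where
  "clinear_op T \<longleftrightarrow> (\<forall>c x. T (c *\<^sub>C x) = c *\<^sub>C T x)"

lift_definition scaleC_op :: "complex \<Rightarrow> ('h::chilbert_space \<Rightarrow>\<^sub>L 'h) \<Rightarrow> ('h \<Rightarrow>\<^sub>L 'h)"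
  is "\<lambda>c T x. c *\<^sub>C T x"
proof -
  fix c and T :: "'h \<Rightarrow> 'h"
  assume T: "bounded_linear T"
  have "bounded_linear (\<lambda>x::'h. c *\<^sub>C x)"
  proof (rule bounded_linear_intro[where K = "cmod c"])
    show "c *\<^sub>C (r *\<^sub>R x) = r *\<^sub>R (c *\<^sub>C x)" for r and x :: 'h
      by (metis mult.commute scaleC_of_real scaleC_scaleC)
  qed (simp_all add: scaleC_add_right norm_scaleC mult.commute)
  then show "bounded_linear (\<lambda>x. c *\<^sub>C T x)"
    using T by (rule bounded_linear_compose)
qed

definition is_adjoint :: "('h::chilbert_space \<Rightarrow>\<^sub>L 'h) \<Rightarrow> ('h \<Rightarrow>\<^sub>L 'h) \<Rightarrow> bool" where
  "is_adjoint T S \<longleftrightarrow> (\<forall>x y. cinner (T x) y = cinner x (S y))"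

text \<open>A von Neumann algebra: a strongly closed unital *-subalgebra of \<open>B(H)\<close>.\<close>

definition von_neumann_algebra :: "('h::chilbert_space \<Rightarrow>\<^sub>L 'h) set \<Rightarrow> bool" where
  "von_neumann_algebra M \<longleftrightarrow>
     (\<forall>T\<in>M. clinear_op T) \<and>
     id_blinfun \<in> M \<and>
     (\<forall>S\<in>M. \<forall>T\<in>M. S + T \<in> M) \<and>
     (\<forall>c. \<forall>T\<in>M. scaleC_op c T \<in> M) \<and>
     (\<forall>S\<in>M. \<forall>T\<in>M. S o\<^sub>L T \<in> M) \<and>
     (\<forall>T\<in>M. \<exists>S\<in>M. is_adjoint T S) \<and>
     closedin strong_operator_topology M"

definition commutative_algebra :: "('h::chilbert_space \<Rightarrow>\<^sub>L 'h) set \<Rightarrow> bool" where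
  "commutative_algebra M \<longleftrightarrow> (\<forall>S\<in>M. \<forall>T\<in>M. S o\<^sub>L T = T o\<^sub>L S)"

definition positive_op :: "('h::chilbert_space \<Rightarrow>\<^sub>L 'h) \<Rightarrow> bool" where
  "positive_op T \<longleftrightarrow> clinear_op T \<and> (\<forall>x. cinner x (T x) \<in> \<real>\<^sub>\<ge>\<^sub>0)"

definition le_op :: "('h::chilbert_space \<Rightarrow>\<^sub>L 'h) \<Rightarrow> ('h \<Rightarrow>\<^sub>L 'h) \<Rightarrow> bool" where
  "le_op S T \<longleftrightarrow> positive_op (T - S)"

definition is_inverse_op :: "('h::chilbert_space \<Rightarrow>\<^sub>L 'h) \<Rightarrow> ('h \<Rightarrow>\<^sub>L 'h) \<Rightarrow> bool" where
  "is_inverse_op T S \<longleftrightarrow> S o\<^sub>L T = id_blinfun \<and> T o\<^sub>L S = id_blinfun"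

text \<open>\<open>pos_inv M\<close> is the set of all positive elements of \<open>M\<close> that are invertible in \<open>M\<close>.\<close>

definition pos_inv :: "('h::chilbert_space \<Rightarrow>\<^sub>L 'h) set \<Rightarrow> ('h \<Rightarrow>\<^sub>L 'h) set" where
  "pos_inv M = {T \<in> M. positive_op T \<and> (\<exists>S\<in>M. is_inverse_op T S)}"

text \<open>The inverse of an invertible operator and the unique positive square root of a positive one
  (both meaningless otherwise).\<close>

definition inv_op :: "('h::chilbert_space \<Rightarrow>\<^sub>L 'h) \<Rightarrow> ('h \<Rightarrow>\<^sub>L 'h)" where
  "inv_op T = (THE S. is_inverse_op T S)"

definition sqrt_op :: "('h::chilbert_space \<Rightarrow>\<^sub>L 'h) \<Rightarrow> ('h \<Rightarrow>\<^sub>L 'h)" where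
  "sqrt_op T = (THE S. positive_op S \<and> S o\<^sub>L S = T)"

definition geometric_mean :: "('h::chilbert_space \<Rightarrow>\<^sub>L 'h) \<Rightarrow> ('h \<Rightarrow>\<^sub>L 'h) \<Rightarrow> ('h \<Rightarrow>\<^sub>L 'h)" where
  "geometric_mean A B =
     sqrt_op A o\<^sub>L
     sqrt_op (inv_op (sqrt_op A) o\<^sub>L B o\<^sub>L inv_op (sqrt_op A)) o\<^sub>L
     sqrt_op A"

definition wasserstein_mean :: "('h::chilbert_space \<Rightarrow>\<^sub>L 'h) \<Rightarrow> ('h \<Rightarrow>\<^sub>L 'h) \<Rightarrow> ('h \<Rightarrow>\<^sub>L 'h)" where
  "wasserstein_mean A B =
     (1/4) *\<^sub>R (A + B + (A o\<^sub>L geometric_mean (inv_op A) B) + (geometric_mean (inv_op A) B o\<^sub>L A))"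

definition order_determining ::
  "('h::chilbert_space \<Rightarrow>\<^sub>L 'h) set \<Rightarrow>
    (('h \<Rightarrow>\<^sub>L 'h) \<Rightarrow> ('h \<Rightarrow>\<^sub>L 'h) \<Rightarrow> ('h \<Rightarrow>\<^sub>L 'h)) \<Rightarrow> bool" where
  "order_determining M \<sigma> \<longleftrightarrow>
     (\<forall>A\<in>pos_inv M. \<forall>B\<in>pos_inv M.
        le_op A B \<longleftrightarrow> (\<forall>X\<in>pos_inv M. norm (\<sigma> A X) \<le> norm (\<sigma> B X)))"

end

theory Submission
  imports Defs
begin

text \<open>
  The element \<open>G = A\<^sup>-\<^sup>1 # X\<close> is the positive solution of the Riccati equation \<open>G A G = X\<close>, and in terms of
  it the Wasserstein mean of \<open>A\<close> and \<open>X\<close> is \<open>(1 + G) A (1 + G) / 4\<close>.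

  If \<open>M\<close> is commutative, the norm of this mean is \<open>\<parallel>a + x\<parallel>\<^sup>2 / 4\<close> with \<open>a\<^sup>2 = A\<close> and \<open>x\<^sup>2 = X\<close>.
  Monotonicity of the square root gives one direction of the order determining property, and the choice
  \<open>x = c - b\<close> with a large scalar \<open>c\<close> and \<open>b\<^sup>2 = B\<close> gives the other.

  Conversely, suppose that some projection \<open>p\<close> in \<open>M\<close> is not central. For \<open>A = p + a (1 - p)\<close> with
  \<open>a < 1\<close>, the norm of the mean of \<open>A\<close> and \<open>t\<^sup>2 X\<close> is \<open>(1 + 2 t \<parallel>p G p\<parallel> + O(t\<^sup>2)) / 4\<close>, while \<open>A \<mapsto> A\<^sup>-\<^sup>1 # X\<close> is
  decreasing. For an \<open>X\<close> built from an off-diagonal element of \<open>M\<close> the norm of the corner \<open>p G p\<close>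
  strictly decreases with \<open>a\<close>, which contradicts the order determining property. Hence all projections
  are central, and spectral projections show that \<open>M\<close> is commutative.
\<close>

section \<open>Positive operators on a real inner product space\<close>

definition symmetric_op :: "('h::real_inner \<Rightarrow>\<^sub>L 'h) \<Rightarrow> bool" where
  "symmetric_op T \<longleftrightarrow> (\<forall>x y. inner (T x) y = inner x (T y))"

text \<open>Symmetry is demanded separately because over the reals a nonnegative quadratic form does
  not force it. By \<open>positive_op_iff\<close>, for complex-linear operators this is ordinary
  positivity, so order estimates can be made in the real inner product.\<close>

definition psd :: "('h::real_inner \<Rightarrow>\<^sub>L 'h) \<Rightarrow> bool" where
  "psd T \<longleftrightarrow> symmetric_op T \<and> (\<forall>x. 0 \<le> inner x (T x))"

lemma symmetric_opD: "symmetric_op T \<Longrightarrow> inner (T x) y = inner x (T y)"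
  by (simp add: symmetric_op_def)

lemma psd_symmetric: "psd T \<Longrightarrow> symmetric_op T"
  by (simp add: psd_def)

lemma psd_nonneg: "psd T \<Longrightarrow> 0 \<le> inner x (T x)"
  by (simp add: psd_def)

lemma symmetric_op_id [simp]: "symmetric_op id_blinfun"
  by (simp add: symmetric_op_def)

lemma symmetric_op_zero [simp]: "symmetric_op 0"
  by (simp add: symmetric_op_def)

lemma symmetric_op_add: "symmetric_op S \<Longrightarrow> symmetric_op T \<Longrightarrow> symmetric_op (S + T)"
  by (simp add: symmetric_op_def blinfun.add_left inner_add_left inner_add_right)

lemma symmetric_op_diff: "symmetric_op S \<Longrightarrow> symmetric_op T \<Longrightarrow> symmetric_op (S - T)"
  by (simp add: symmetric_op_def blinfun.diff_left inner_diff_left inner_diff_right)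

lemma symmetric_op_scaleR: "symmetric_op T \<Longrightarrow> symmetric_op (r *\<^sub>R T)"
  by (simp add: symmetric_op_def blinfun.scaleR_left)

lemma symmetric_op_conj: "symmetric_op S \<Longrightarrow> symmetric_op T \<Longrightarrow> symmetric_op (T o\<^sub>L S o\<^sub>L T)"
  by (simp add: symmetric_op_def)

lemma symmetric_op_square: "symmetric_op T \<Longrightarrow> symmetric_op (T o\<^sub>L T)"
  by (simp add: symmetric_op_def)

lemma psd_id [simp]: "psd id_blinfun"
  by (simp add: psd_def)

lemma psd_zero [simp]: "psd 0"
  by (simp add: psd_def)

lemma psd_add: "psd S \<Longrightarrow> psd T \<Longrightarrow> psd (S + T)"
  by (simp add: psd_def symmetric_op_add blinfun.add_left inner_add_right)

lemma psd_scaleR: "psd T \<Longrightarrow> 0 \<le> r \<Longrightarrow> psd (r *\<^sub>R T)"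
  by (simp add: psd_def symmetric_op_scaleR blinfun.scaleR_left)

lemma psd_conj: "psd S \<Longrightarrow> symmetric_op T \<Longrightarrow> psd (T o\<^sub>L S o\<^sub>L T)"
  by (simp add: psd_def symmetric_op_conj flip: symmetric_opD[of T])

lemma psd_square: "symmetric_op T \<Longrightarrow> psd (T o\<^sub>L T)"
  unfolding psd_def by (auto simp: symmetric_op_square) (metis symmetric_opD inner_ge_zero)

lemma psd_diffI:
  assumes "symmetric_op S" "symmetric_op T" "\<And>x. inner x (S x) \<le> inner x (T x)"
  shows "psd (T - S)"
  using assms by (simp add: psd_def symmetric_op_diff blinfun.diff_left inner_diff_right)

lemma inner_apply_le: "inner x (T x) \<le> norm T * (norm x)\<^sup>2"
  for T :: "'h::real_inner \<Rightarrow>\<^sub>L 'h"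
proof -
  have "inner x (T x) \<le> norm x * norm (T x)" by (rule norm_cauchy_schwarz)
  also have "\<dots> \<le> norm x * (norm T * norm x)" by (intro mult_left_mono norm_blinfun) simp
  finally show ?thesis by (simp add: power2_eq_square mult_ac)
qed

lemma psd_diff_scaled_id:
  assumes "symmetric_op T" "norm T \<le> c"
  shows "psd (c *\<^sub>R id_blinfun - T)"
proof (rule psd_diffI)
  fix x
  have "inner x (T x) \<le> norm T * (norm x)\<^sup>2" by (rule inner_apply_le)
  also have "\<dots> \<le> c * (norm x)\<^sup>2" using assms(2) by (intro mult_right_mono) auto
  finally show "inner x (T x) \<le> inner x ((c *\<^sub>R id_blinfun) x)"
    by (simp add: blinfun.scaleR_left power2_norm_eq_inner)
qed (use assms in \<open>auto intro: symmetric_op_scaleR\<close>)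

text \<open>The form at \<open>x + r y\<close> is a nonnegative quadratic polynomial in
  \<open>r\<close>; its value at the minimiser gives the inequality.\<close>

lemma psd_Cauchy_Schwarz:
  assumes "psd T"
  shows "(inner x (T y))\<^sup>2 \<le> inner x (T x) * inner y (T y)"
proof -
  let ?a = "inner x (T x)" and ?b = "inner x (T y)" and ?c = "inner y (T y)"
  have q: "0 \<le> ?a + 2 * r * ?b + r\<^sup>2 * ?c" for r
  proof -
    have "inner y (T x) = ?b" using assms by (metis inner_commute psd_symmetric symmetric_opD)
    then show ?thesis
      using psd_nonneg[OF assms, of "x + r *\<^sub>R y"]
      by (simp add: blinfun.add_right blinfun.scaleR_right inner_add_left inner_add_right
          power2_eq_square algebra_simps)
  qed
  show ?thesis
  proof (cases "?c = 0")
    case True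
    have "?b = 0"
    proof (rule ccontr)
      assume "?b \<noteq> 0"
      \<comment> \<open>With \<open>?c = 0\<close> the polynomial is affine, and this
        \<open>r\<close> gives it the value -1.\<close>
      then show False using q[of "- (?a + 1) / (2 * ?b)"] True by (simp add: field_simps)
    qed
    then show ?thesis using True by simp
  next
    case False
    then have "?c > 0" using psd_nonneg[OF assms, of y] by simp
    then show ?thesis
      using q[of "- ?b / ?c"] by (simp add: field_simps power2_eq_square)
  qed
qed

text \<open>Cauchy-Schwarz for the form at the pair \<open>T x\<close>, \<open>x\<close> bounds the
  fourth power of the norm of \<open>T x\<close> by a product of two values of the form, so bounding
  the form bounds the norm.\<close>

lemma psd_norm_le:
  assumes "psd T" "\<And>x. inner x (T x) \<le> c * (norm x)\<^sup>2" "0 \<le> c"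
  shows "norm T \<le> c"
proof (rule norm_blinfun_bound[OF assms(3)])
  fix x
  have "(norm (T x))\<^sup>2 * (norm (T x))\<^sup>2 = (inner (T x) (T x))\<^sup>2"
    by (simp only: power2_norm_eq_inner power2_eq_square[of "inner _ _"])
  also have "\<dots> \<le> inner (T x) (T (T x)) * inner x (T x)"
    by (rule psd_Cauchy_Schwarz[OF assms(1)])
  also have "\<dots> \<le> (c * (norm (T x))\<^sup>2) * (c * (norm x)\<^sup>2)"
    by (intro mult_mono assms psd_nonneg mult_nonneg_nonneg) auto
  also have "\<dots> = (norm (T x))\<^sup>2 * (c * norm x)\<^sup>2"
    by (simp add: power2_eq_square)
  finally have "(norm (T x))\<^sup>2 \<le> (c * norm x)\<^sup>2 \<or> norm (T x) = 0"
    by (metis mult_le_cancel_left_pos zero_less_norm_iff zero_less_power norm_eq_zero)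
  then show "norm (T x) \<le> c * norm x"
    using assms(3) by (auto intro: power2_le_imp_le)
qed

text \<open>Forces \<open>T x\<close> to be small wherever the form of \<open>T\<close> is small,
  which turns near-minimisers of a form into approximate eigenvectors.\<close>

lemma psd_norm_apply:
  assumes "psd T"
  shows "(norm (T x))\<^sup>2 \<le> norm T * inner x (T x)"
proof -
  have "(norm (T x))\<^sup>2 * (norm (T x))\<^sup>2 = (inner (T x) (T x))\<^sup>2"
    by (simp only: power2_norm_eq_inner power2_eq_square[of "inner _ _"])
  also have "\<dots> \<le> inner (T x) (T (T x)) * inner x (T x)"
    by (rule psd_Cauchy_Schwarz[OF assms(1)])
  also have "\<dots> \<le> (norm T * (norm (T x))\<^sup>2) * inner x (T x)"
    by (intro mult_right_mono inner_apply_le psd_nonneg assms)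
  also have "\<dots> = (norm T * inner x (T x)) * (norm (T x))\<^sup>2" by (simp add: mult_ac)
  finally have le: "(norm (T x))\<^sup>2 * (norm (T x))\<^sup>2 \<le> (norm T * inner x (T x)) * (norm (T x))\<^sup>2" .
  show ?thesis
  proof (cases "T x = 0")
    case False
    then have "0 < (norm (T x))\<^sup>2" by simp
    with le show ?thesis by (rule mult_right_le_imp_le)
  qed simp
qed

lemma psd_antisym:
  assumes "psd (S - T)" "psd (T - S)"
  shows "S = T"
proof -
  have "inner x ((S - T) x) \<le> 0 * (norm x)\<^sup>2" for x
    using psd_nonneg[OF assms(2), of x] by (simp add: blinfun.diff_left inner_diff_right)
  then have "norm (S - T) \<le> 0"
    by (rule psd_norm_le[OF assms(1)]) simp
  then show ?thesis by simp
qed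

lemma norm_square_symmetric:
  assumes "symmetric_op T"
  shows "norm (T o\<^sub>L T) = (norm T)\<^sup>2"
proof (rule antisym)
  show "norm (T o\<^sub>L T) \<le> (norm T)\<^sup>2"
    by (metis norm_blinfun_compose power2_eq_square)
  have "norm T \<le> sqrt (norm (T o\<^sub>L T))"
  proof (rule norm_blinfun_bound)
    fix x
    have "(norm (T x))\<^sup>2 = inner x ((T o\<^sub>L T) x)"
      using assms by (simp add: power2_norm_eq_inner symmetric_opD)
    also have "\<dots> \<le> norm (T o\<^sub>L T) * (norm x)\<^sup>2" by (rule inner_apply_le)
    also have "\<dots> = (sqrt (norm (T o\<^sub>L T)) * norm x)\<^sup>2" by (simp add: power_mult_distrib)
    finally show "norm (T x) \<le> sqrt (norm (T o\<^sub>L T)) * norm x"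
      by (auto intro: power2_le_imp_le)
  qed simp
  then show "(norm T)\<^sup>2 \<le> norm (T o\<^sub>L T)"
    by (metis norm_ge_zero real_sqrt_ge_zero real_sqrt_pow2 power_mono)
qed

text \<open>If \<open>- k < 0\<close> is the bottom of the spectrum of \<open>T - S\<close> and \<open>x\<close> is an approximate unit
  eigenvector for it, then \<open>\<langle>x, (T\<^sup>2 - S\<^sup>2) x\<rangle> = \<langle>(T - S) x, (T + S) x\<rangle> \<approx> - k \<langle>x, (T + S) x\<rangle>\<close>
  and \<open>\<langle>x, (T + S) x\<rangle> \<ge> - \<langle>x, (T - S) x\<rangle> \<approx> k\<close>.\<close>

lemma psd_diff_of_square_le:
  assumes S: "symmetric_op S" and T: "psd T" and le: "psd ((T o\<^sub>L T) - (S o\<^sub>L S))"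
  shows "psd (T - S)"
proof (rule ccontr)
  assume neg: "\<not> psd (T - S)"
  let ?D = "T - S" and ?N = "{x::'a. norm x = 1}"
  have sT: "symmetric_op T" using T by (rule psd_symmetric)
  have sD: "symmetric_op ?D" using sT S by (rule symmetric_op_diff)
  define k where "k = (SUP x\<in>?N. - inner x (?D x))"
  have bdd: "bdd_above ((\<lambda>x. - inner x (?D x)) ` ?N)"
  proof (rule bdd_aboveI2)
    show "- inner x (?D x) \<le> norm (- ?D)" if "x \<in> ?N" for x
      using inner_apply_le[of x "- ?D"] that by (simp only: blinfun.minus_left inner_minus_right) simp
  qed
  from neg sD obtain x0 where x0: "inner x0 (?D x0) < 0"
    by (auto simp: psd_def not_le)
  then have nz: "x0 \<noteq> 0" by auto
  have unit: "- inner x (?D x) \<le> k" if "norm x = 1" for x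
    unfolding k_def by (rule cSUP_upper[OF _ bdd]) (use that in simp)
  have sc: "inner (x /\<^sub>R norm x) (?D (x /\<^sub>R norm x)) = inner x (?D x) / (norm x)\<^sup>2" for x
    by (simp add: blinfun.scaleR_right power2_eq_square field_simps)
  have ge: "- inner x (?D x) \<le> k * (norm x)\<^sup>2" for x
  proof (cases "x = 0")
    case False
    then show ?thesis using unit[of "x /\<^sub>R norm x"] unfolding sc by (simp add: field_simps)
  qed simp
  have "0 < - inner x0 (?D x0)" using x0 by simp
  also have "\<dots> \<le> k * (norm x0)\<^sup>2" by (rule ge)
  finally have k: "k > 0" using nz by (simp add: zero_less_mult_iff)
  \<comment> \<open>Since \<open>k\<close> is a supremum, this shift of \<open>?D\<close> is
    positive, and its form is small at unit vectors where the supremum is nearly attained.\<close>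
  define E where "E = k *\<^sub>R id_blinfun + ?D"
  have "symmetric_op E"
    unfolding E_def using sD by (intro symmetric_op_add symmetric_op_scaleR symmetric_op_id)
  moreover have "0 \<le> inner x (E x)" for x
    using ge[of x] by (simp add: E_def blinfun.add_left blinfun.scaleR_left inner_add_right
        flip: power2_norm_eq_inner)
  ultimately have E: "psd E" by (simp add: psd_def)
  define C where "C = norm E * (norm (T + S))\<^sup>2"
  have C: "0 \<le> C" by (simp add: C_def)
  have main: "(k * (k - \<delta>))\<^sup>2 \<le> C * \<delta>" if \<delta>: "0 < \<delta>" "\<delta> < k" for \<delta>
  proof -
    have "k - \<delta> < k" using \<delta> by simp
    moreover have "?N \<noteq> {}" using nz by (auto intro!: exI[of _ "x0 /\<^sub>R norm x0"])
    ultimately obtain x where x: "norm x = 1" "k - \<delta> < - inner x (?D x)"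
      unfolding k_def by (subst (asm) less_cSUP_iff[OF _ bdd]) auto
    have xE: "inner x (E x) < \<delta>"
      using x by (simp add: E_def blinfun.add_left blinfun.scaleR_left inner_add_right
          flip: power2_norm_eq_inner)
    let ?s = "inner x ((T + S) x)"
    have s: "k - \<delta> \<le> ?s"
      using psd_nonneg[OF T, of x] x(2)
      by (simp add: blinfun.add_left blinfun.diff_left inner_add_right inner_diff_right)
    have "0 \<le> inner x (((T o\<^sub>L T) - (S o\<^sub>L S)) x)" by (rule psd_nonneg[OF le])
    also have "\<dots> = inner (?D x) ((T + S) x)"
      by (simp add: blinfun.add_left blinfun.diff_left inner_add_right inner_diff_right
          inner_diff_left inner_commute[of "S x" "T x"]
          symmetric_opD[OF sT, of x, symmetric] symmetric_opD[OF S, of x, symmetric])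
    also have "?D x = E x - k *\<^sub>R x"
      by (simp add: E_def blinfun.add_left blinfun.scaleR_left)
    finally have "k * ?s \<le> inner (E x) ((T + S) x)"
      by (simp add: inner_diff_left)
    also have "\<dots> \<le> norm (E x) * norm ((T + S) x)" by (rule norm_cauchy_schwarz)
    also have "\<dots> \<le> norm (E x) * norm (T + S)"
      using norm_blinfun[of "T + S" x] x(1) by (intro mult_left_mono) auto
    finally have "k * (k - \<delta>) \<le> norm (E x) * norm (T + S)"
      using s k by (meson mult_left_mono order_trans less_imp_le)
    then have "(k * (k - \<delta>))\<^sup>2 \<le> (norm (E x) * norm (T + S))\<^sup>2"
      using k \<delta> by (intro power_mono) auto
    also have "\<dots> = (norm (E x))\<^sup>2 * (norm (T + S))\<^sup>2" by (rule power_mult_distrib)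
    also have "\<dots> \<le> (norm E * \<delta>) * (norm (T + S))\<^sup>2"
      by (intro mult_right_mono order_trans[OF psd_norm_apply[OF E]] mult_left_mono less_imp_le[OF xE])
        simp_all
    finally show ?thesis by (simp add: C_def mult_ac)
  qed
  \<comment> \<open>Letting \<delta> tend to 0 in \<open>main\<close> leaves
    \<open>k^4 \<le> 0\<close>.\<close>
  have "((\<lambda>\<delta>. C * \<delta> - (k * (k - \<delta>))\<^sup>2) \<longlongrightarrow> C * 0 - (k * (k - 0))\<^sup>2) (at_right 0)"
    by (intro tendsto_intros)
  moreover have "\<forall>\<^sub>F \<delta> in at_right 0. 0 \<le> C * \<delta> - (k * (k - \<delta>))\<^sup>2"
    unfolding eventually_at_right_field using main k by (intro exI[of _ k]) auto
  ultimately have "0 \<le> C * 0 - (k * (k - 0))\<^sup>2"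
    by (rule tendsto_lowerbound) simp
  then have "k * k = 0" by simp
  then show False using k by simp
qed

lemma psd_sqrt_unique:
  assumes "psd S" "psd T" "S o\<^sub>L S = T o\<^sub>L T"
  shows "S = T"
proof (rule psd_antisym)
  show "psd (S - T)"
    by (rule psd_diff_of_square_le) (simp_all only: assms psd_symmetric diff_self psd_zero)
  show "psd (T - S)"
    by (rule psd_diff_of_square_le) (simp_all only: assms psd_symmetric diff_self psd_zero)
qed

section \<open>Square roots and the Riccati equation\<close>

lemma clinear_op_scaleC: "clinear_op T \<Longrightarrow> T (c *\<^sub>C x) = c *\<^sub>C T x"
  by (simp add: clinear_op_def)

lemma cinner_scaleC_left: "cinner (a *\<^sub>C x) y = cnj a * cinner x (y :: 'h::chilbert_space)"
  by (metis cinner_commute cinner_scaleC_right complex_cnj_mult)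

lemma cinner_add_left: "cinner (x + y) z = cinner x z + cinner y (z :: 'h::chilbert_space)"
  by (metis cinner_commute cinner_add_right complex_cnj_add)

lemma Im_cinner: "Im (cinner x y) = - inner x (\<i> *\<^sub>C (y :: 'h::chilbert_space))"
  by (simp add: inner_eq_Re_cinner cinner_scaleC_right)

lemma inner_scaleC_i: "inner (\<i> *\<^sub>C x) y = - inner x (\<i> *\<^sub>C (y :: 'h::chilbert_space))"
  by (simp add: inner_eq_Re_cinner cinner_scaleC_right cinner_scaleC_left)

lemma is_adjoint_inner: "is_adjoint T S \<Longrightarrow> inner (T x) y = inner x (S y)"
  by (simp add: is_adjoint_def inner_eq_Re_cinner)

text \<open>Reality of \<open>cinner\<close> at \<open>x\<close>, at \<open>y\<close> and at
  \<open>x + i y\<close> gives symmetry by polarization. Conversely, moving \<open>i\<close> through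
  a symmetric complex-linear operator shows that the imaginary part of \<open>cinner x (T x)\<close>
  vanishes.\<close>

lemma positive_op_iff: "positive_op T \<longleftrightarrow> clinear_op T \<and> psd T"
proof safe
  assume T: "positive_op T"
  then show lin: "clinear_op T" by (simp add: positive_op_def)
  have pos: "cinner x (T x) \<in> \<real>\<^sub>\<ge>\<^sub>0" for x using T by (simp add: positive_op_def)
  then have Im0: "Im (cinner x (T x)) = 0" for x by (simp add: complex_nonneg_Reals_iff)
  have "symmetric_op T"
    unfolding symmetric_op_def
  proof (intro allI)
    fix x y
    have "Im (cinner (x + \<i> *\<^sub>C y) (T (x + \<i> *\<^sub>C y))) = 0" by (rule Im0)
    then have "Re (cinner x (T y)) = Re (cinner y (T x))"
      using Im0[of x] Im0[of y]
      by (simp add: blinfun.add_right clinear_op_scaleC[OF lin] cinner_add_left cinner_add_right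
          cinner_scaleC_left cinner_scaleC_right)
    then show "inner (T x) y = inner x (T y)"
      by (simp add: inner_eq_Re_cinner[symmetric] inner_commute)
  qed
  moreover have "0 \<le> inner x (T x)" for x
    using pos[of x] by (simp add: complex_nonneg_Reals_iff inner_eq_Re_cinner)
  ultimately show "psd T" by (simp add: psd_def)
next
  assume lin: "clinear_op T" and psd: "psd T"
  have "Im (cinner x (T x)) = 0" for x
  proof -
    have "inner x (T (\<i> *\<^sub>C x)) = inner (T x) (\<i> *\<^sub>C x)"
      by (simp add: symmetric_opD[OF psd_symmetric[OF psd]])
    also have "\<dots> = - inner x (\<i> *\<^sub>C T x)"
      by (simp add: inner_commute[of "T x"] inner_scaleC_i)
    finally show ?thesis by (simp add: Im_cinner clinear_op_scaleC[OF lin])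
  qed
  then show "positive_op T"
    using lin psd_nonneg[OF psd]
    by (simp add: positive_op_def complex_nonneg_Reals_iff inner_eq_Re_cinner)
qed

lemma compose_left_cong: "S o\<^sub>L T = U \<Longrightarrow> S (T x) = U x"
  by (metis blinfun_apply_blinfun_compose)

lemma blinfun_compose_assoc: "(S o\<^sub>L T) o\<^sub>L U = S o\<^sub>L (T o\<^sub>L U)"
  by (rule blinfun_eqI) simp

lemma blinfun_compose_id [simp]: "T o\<^sub>L id_blinfun = T" "id_blinfun o\<^sub>L T = T"
  by (auto intro!: blinfun_eqI)

lemmas blinfun_compose_distrib =
  bounded_bilinear.add_left[OF bounded_bilinear_blinfun_compose]
  bounded_bilinear.add_right[OF bounded_bilinear_blinfun_compose]
  bounded_bilinear.diff_left[OF bounded_bilinear_blinfun_compose]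
  bounded_bilinear.diff_right[OF bounded_bilinear_blinfun_compose]
  bounded_bilinear.scaleR_left[OF bounded_bilinear_blinfun_compose]
  bounded_bilinear.scaleR_right[OF bounded_bilinear_blinfun_compose]

lemma inv_op_eq:
  assumes "is_inverse_op T S"
  shows "inv_op T = S"
  unfolding inv_op_def
proof (rule the_equality)
  show "is_inverse_op T S" by (rule assms)
  fix S' assume "is_inverse_op T S'"
  then show "S' = S"
    using assms unfolding is_inverse_op_def
    by (metis blinfun_compose_assoc blinfun_compose_id)
qed

lemma is_inverse_opI:
  assumes "U o\<^sub>L T = id_blinfun" "T o\<^sub>L V = id_blinfun"
  shows "is_inverse_op T V"
proof -
  have "U = V" using assms by (metis blinfun_compose_assoc blinfun_compose_id)
  then show ?thesis using assms by (simp add: is_inverse_op_def)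
qed

lemma sqrt_op_eq:
  assumes "positive_op S"
  shows "sqrt_op (S o\<^sub>L S) = S"
  unfolding sqrt_op_def
  by (rule the_equality) (use assms in \<open>auto simp: positive_op_iff intro: psd_sqrt_unique\<close>)

lemma psd_inverse:
  assumes "psd T" "is_inverse_op T S"
  shows "psd S"
proof -
  have TS: "T (S x) = x" and ST: "S (T x) = x" for x
    using assms(2) by (simp_all add: is_inverse_op_def compose_left_cong)
  have "inner (S x) y = inner x (S y)" for x y
    by (metis TS assms(1) psd_symmetric symmetric_opD)
  moreover have "0 \<le> inner x (S x)" for x
    by (metis TS assms(1) psd_nonneg inner_commute)
  ultimately show ?thesis by (simp add: psd_def symmetric_op_def)
qed

text \<open>Since \<open>a X a\<close> is the square of the positive operator \<open>a G a\<close>,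
  the geometric mean of the inverse of \<open>A\<close> with \<open>X\<close> is
  \<open>b (a G a) b = G\<close>. Then \<open>A + X + A G + G A\<close> factors as
  \<open>(1 + G) A (1 + G)\<close>.\<close>

lemma wasserstein_mean_Riccati:
  assumes a: "positive_op a" "is_inverse_op a b" "clinear_op b" and G: "positive_op G"
    and A: "A = a o\<^sub>L a" and X: "X = G o\<^sub>L A o\<^sub>L G"
  shows "wasserstein_mean A X =
    (1/4) *\<^sub>R ((id_blinfun + G) o\<^sub>L A o\<^sub>L (id_blinfun + G))"
proof -
  have ab: "a (b x) = x" and ba: "b (a x) = x" for x
    using a(2) by (simp_all add: is_inverse_op_def compose_left_cong)
  have b: "positive_op b"
    using a psd_inverse by (auto simp: positive_op_iff)
  have "is_inverse_op A (b o\<^sub>L b)"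
    unfolding is_inverse_op_def A by (auto intro!: blinfun_eqI simp: ab ba)
  then have iA: "inv_op A = b o\<^sub>L b" by (rule inv_op_eq)
  have ib: "inv_op b = a" using a(2) by (intro inv_op_eq) (simp add: is_inverse_op_def)
  have aGa: "positive_op (a o\<^sub>L G o\<^sub>L a)"
    using a G by (auto simp: positive_op_iff psd_conj psd_symmetric clinear_op_def)
  have "a o\<^sub>L X o\<^sub>L a = (a o\<^sub>L G o\<^sub>L a) o\<^sub>L (a o\<^sub>L G o\<^sub>L a)"
    by (auto intro!: blinfun_eqI simp: X A)
  then have "geometric_mean (inv_op A) X = b o\<^sub>L (a o\<^sub>L G o\<^sub>L a) o\<^sub>L b"
    by (simp add: geometric_mean_def iA sqrt_op_eq[OF b] ib sqrt_op_eq[OF aGa])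
  also have "\<dots> = G" by (auto intro!: blinfun_eqI simp: ab ba)
  finally show ?thesis
    unfolding wasserstein_mean_def
    by (auto intro!: blinfun_eqI simp: X blinfun.add_left blinfun.add_right blinfun.scaleR_left)
qed

section \<open>Square roots by the iteration \<open>Y -> (R + Y Y) / 2\<close>\<close>

fun sqrt_iter :: "('h::real_normed_vector \<Rightarrow>\<^sub>L 'h) \<Rightarrow> nat \<Rightarrow> ('h \<Rightarrow>\<^sub>L 'h)" where
  "sqrt_iter R 0 = 0"
| "sqrt_iter R (Suc n) = (1/2) *\<^sub>R (R + (sqrt_iter R n o\<^sub>L sqrt_iter R n))"

text \<open>The same iteration run on the number 1; it majorizes the operator iteration for every
  \<open>R\<close> of norm at most 1.\<close>

fun sqrt_iter_bound :: "nat \<Rightarrow> real" where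
  "sqrt_iter_bound 0 = 0"
| "sqrt_iter_bound (Suc n) = (1/2) * (1 + sqrt_iter_bound n * sqrt_iter_bound n)"

lemma sqrt_iter_bound_range: "0 \<le> sqrt_iter_bound n \<and> sqrt_iter_bound n \<le> 1"
proof (induction n)
  case (Suc n)
  then have "sqrt_iter_bound n * sqrt_iter_bound n \<le> 1" by (simp add: mult_le_one)
  with Suc show ?case by simp
qed simp

lemma norm_sqrt_iter:
  assumes "norm R \<le> 1"
  shows "norm (sqrt_iter R n) \<le> sqrt_iter_bound n"
proof (induction n)
  case (Suc n)
  let ?Y = "sqrt_iter R n" and ?y = "sqrt_iter_bound n"
  have "norm (R + (?Y o\<^sub>L ?Y)) \<le> norm R + norm (?Y o\<^sub>L ?Y)"
    by (rule norm_triangle_ineq)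
  also have "\<dots> \<le> 1 + ?y * ?y"
    by (intro add_mono assms order_trans[OF norm_blinfun_compose] mult_mono Suc) (simp_all add: sqrt_iter_bound_range)
  finally show ?case by simp
qed simp

text \<open>Writing \<open>Y Y - Z Z = Y (Y - Z) + (Y - Z) Z\<close> bounds each increment by the
  previous one, and the scalar majorant satisfies the same recursion with equality.\<close>

lemma norm_sqrt_iter_diff:
  assumes "norm R \<le> 1"
  shows "norm (sqrt_iter R (Suc n) - sqrt_iter R n) \<le> sqrt_iter_bound (Suc n) - sqrt_iter_bound n"
proof (induction n)
  case 0
  then show ?case using assms by simp
next
  case (Suc n)
  let ?Y = "sqrt_iter R (Suc n)" and ?Z = "sqrt_iter R n"
  let ?y = "sqrt_iter_bound (Suc n)" and ?z = "sqrt_iter_bound n"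
  have y0: "0 \<le> ?y" using sqrt_iter_bound_range by blast
  have d0: "0 \<le> ?y - ?z" by (rule order_trans[OF norm_ge_zero Suc])
  have "sqrt_iter R (Suc (Suc n)) - ?Y =
      (1/2) *\<^sub>R (R + (?Y o\<^sub>L ?Y)) - (1/2) *\<^sub>R (R + (?Z o\<^sub>L ?Z))"
    by (simp only: sqrt_iter.simps)
  also have "\<dots> = (1/2) *\<^sub>R ((?Y o\<^sub>L ?Y) - (?Z o\<^sub>L ?Z))"
    by (simp only: scaleR_right_diff_distrib[symmetric] add_diff_cancel_left)
  also have "(?Y o\<^sub>L ?Y) - (?Z o\<^sub>L ?Z) = (?Y o\<^sub>L (?Y - ?Z)) + ((?Y - ?Z) o\<^sub>L ?Z)"
    by (simp only: blinfun_compose_distrib) (simp del: sqrt_iter.simps)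
  finally have eq: "sqrt_iter R (Suc (Suc n)) - ?Y =
      (1/2) *\<^sub>R ((?Y o\<^sub>L (?Y - ?Z)) + ((?Y - ?Z) o\<^sub>L ?Z))" .
  have "norm (sqrt_iter R (Suc (Suc n)) - ?Y) = (1/2) * norm ((?Y o\<^sub>L (?Y - ?Z)) + ((?Y - ?Z) o\<^sub>L ?Z))"
    unfolding eq by (simp del: sqrt_iter.simps)
  also have "\<dots> \<le> (1/2) * (?y * (?y - ?z) + (?y - ?z) * ?z)"
    by (intro mult_left_mono order_trans[OF norm_triangle_ineq] add_mono
        order_trans[OF norm_blinfun_compose] mult_mono Suc norm_sqrt_iter assms)
      (rule y0 d0 norm_ge_zero | simp)+
  also have "\<dots> = sqrt_iter_bound (Suc (Suc n)) - ?y"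
  proof -
    have "sqrt_iter_bound (Suc (Suc n)) - ?y = (1/2) * (1 + ?y * ?y) - (1/2) * (1 + ?z * ?z)"
      by (simp only: sqrt_iter_bound.simps)
    then show ?thesis by (simp only: algebra_simps)
  qed
  finally show ?case .
qed

text \<open>The scalar majorant is increasing and bounded, hence Cauchy, and summing increments
  transfers this to the operators.\<close>

lemma sqrt_iter_convergent:
  fixes R :: "'h::banach \<Rightarrow>\<^sub>L 'h"
  assumes R: "norm R \<le> 1"
  shows "convergent (sqrt_iter R)"
proof -
  have inc: "sqrt_iter_bound n \<le> sqrt_iter_bound (Suc n)" for n
    using norm_sqrt_iter_diff[OF R, of n] norm_ge_zero[of "sqrt_iter R (Suc n) - sqrt_iter R n"]
    by linarith
  have "convergent sqrt_iter_bound"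
    by (rule Bseq_mono_convergent)
      (auto intro!: BseqI'[of _ 1] lift_Suc_mono_le[of sqrt_iter_bound, OF inc] simp: sqrt_iter_bound_range)
  then have "Cauchy sqrt_iter_bound" by (rule convergent_Cauchy)
  have le: "norm (sqrt_iter R m - sqrt_iter R n) \<le> sqrt_iter_bound m - sqrt_iter_bound n"
    if "n \<le> m" for m n
    using that
  proof (induction m rule: dec_induct)
    case (step m)
    have "norm (sqrt_iter R (Suc m) - sqrt_iter R n) \<le>
        norm (sqrt_iter R (Suc m) - sqrt_iter R m) + norm (sqrt_iter R m - sqrt_iter R n)"
      by (metis diff_add_cancel add_diff_eq norm_triangle_ineq)
    then show ?case using step norm_sqrt_iter_diff[OF R, of m] by linarith
  qed simp
  have "Cauchy (sqrt_iter R)"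
  proof (rule metric_CauchyI)
    fix e :: real assume "0 < e"
    then obtain N where N: "\<And>m n. m \<ge> N \<Longrightarrow> n \<ge> N \<Longrightarrow> dist (sqrt_iter_bound m) (sqrt_iter_bound n) < e"
      using \<open>Cauchy sqrt_iter_bound\<close> by (meson metric_CauchyD)
    have "dist (sqrt_iter R m) (sqrt_iter R n) < e" if "N \<le> n" "n \<le> m" for m n
      using le[OF that(2)] N[of m n] that by (simp add: dist_norm)
    then show "\<exists>N. \<forall>m\<ge>N. \<forall>n\<ge>N. dist (sqrt_iter R m) (sqrt_iter R n) < e"
      by (metis dist_commute linorder_le_cases)
  qed
  then show ?thesis by (rule Cauchy_convergent)
qed

text \<open>The fixed point equation says that \<open>1 - Y\<close> is a square root of
  \<open>1 - R\<close>.\<close>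

lemma sqrt_iter_limit:
  assumes R: "norm R \<le> 1" and lim: "sqrt_iter R \<longlonglongrightarrow> Y"
  shows "norm Y \<le> 1" and "Y = (1/2) *\<^sub>R (R + (Y o\<^sub>L Y))"
proof -
  show "norm Y \<le> 1"
    by (rule Lim_bounded[OF tendsto_norm[OF lim]])
      (use norm_sqrt_iter[OF R] sqrt_iter_bound_range order_trans in blast)
  have "(\<lambda>n. sqrt_iter R (Suc n)) \<longlonglongrightarrow> (1/2) *\<^sub>R (R + (Y o\<^sub>L Y))"
    by (auto intro!: tendsto_intros bounded_bilinear.tendsto[OF bounded_bilinear_blinfun_compose] lim)
  then show "Y = (1/2) *\<^sub>R (R + (Y o\<^sub>L Y))"
    using LIMSEQ_unique[OF LIMSEQ_Suc[OF lim]] by blast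
qed

lemma symmetric_op_limit:
  assumes lim: "F \<longlonglongrightarrow> T" and "\<And>n. symmetric_op (F n)"
  shows "symmetric_op T"
  unfolding symmetric_op_def
proof (intro allI)
  fix x y
  have "(\<lambda>n. inner (F n x) y) \<longlonglongrightarrow> inner (T x) y" "(\<lambda>n. inner x (F n y)) \<longlonglongrightarrow> inner x (T y)"
    by (auto intro!: tendsto_intros lim)
  then show "inner (T x) y = inner x (T y)"
    using assms(2) by (auto simp: symmetric_op_def intro: LIMSEQ_unique)
qed

lemma commute_limit:
  assumes lim: "F \<longlonglongrightarrow> T" and "\<And>n. C o\<^sub>L F n = F n o\<^sub>L C"
  shows "C o\<^sub>L T = T o\<^sub>L C"
proof (rule LIMSEQ_unique)
  show "(\<lambda>n. C o\<^sub>L F n) \<longlonglongrightarrow> (C o\<^sub>L T)"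
    by (intro bounded_bilinear.tendsto[OF bounded_bilinear_blinfun_compose] lim tendsto_const)
  show "(\<lambda>n. C o\<^sub>L F n) \<longlonglongrightarrow> (T o\<^sub>L C)"
    unfolding assms(2)
    by (intro bounded_bilinear.tendsto[OF bounded_bilinear_blinfun_compose] lim tendsto_const)
qed

section \<open>Closure properties of a von Neumann algebra\<close>

locale vn_algebra =
  fixes M :: "('h::chilbert_space \<Rightarrow>\<^sub>L 'h) set"
  assumes vn: "von_neumann_algebra M"
begin

lemma clinear: "T \<in> M \<Longrightarrow> clinear_op T"
  and id_mem [simp, intro]: "id_blinfun \<in> M"
  and add_mem [intro]: "S \<in> M \<Longrightarrow> T \<in> M \<Longrightarrow> S + T \<in> M"
  and scaleC_mem: "T \<in> M \<Longrightarrow> scaleC_op c T \<in> M"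
  and compose_mem [intro]: "S \<in> M \<Longrightarrow> T \<in> M \<Longrightarrow> S o\<^sub>L T \<in> M"
  and adjoint_mem: "T \<in> M \<Longrightarrow> \<exists>S\<in>M. is_adjoint T S"
  and strongly_closed: "closedin strong_operator_topology M"
  using vn by (simp_all add: von_neumann_algebra_def)

lemma scaleR_mem [intro]: "T \<in> M \<Longrightarrow> r *\<^sub>R T \<in> M"
proof -
  assume "T \<in> M"
  moreover have "scaleC_op (complex_of_real r) T = r *\<^sub>R T"
    by (rule blinfun_eqI) (simp add: scaleC_op.rep_eq scaleC_of_real blinfun.scaleR_left)
  ultimately show ?thesis using scaleC_mem by metis
qed

lemma diff_mem [intro]: "S \<in> M \<Longrightarrow> T \<in> M \<Longrightarrow> S - T \<in> M"
  using add_mem[OF _ scaleR_mem[of T "-1"]] by simp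

lemma zero_mem [simp, intro]: "0 \<in> M"
  using diff_mem[of id_blinfun id_blinfun] by simp

lemma positive_op_iff_psd: "T \<in> M \<Longrightarrow> positive_op T \<longleftrightarrow> psd T"
  by (simp add: positive_op_iff clinear)

text \<open>The strong operator topology is pulled back from the product topology on functions, in
  which pointwise convergence is convergence; a limit outside \<open>M\<close> would drag some
  \<open>F n\<close> out of \<open>M\<close>.\<close>

lemma strong_limit_mem:
  fixes F :: "nat \<Rightarrow> 'h \<Rightarrow>\<^sub>L 'h" and T :: "'h \<Rightarrow>\<^sub>L 'h"
  assumes "\<And>n. F n \<in> M" "\<And>x. (\<lambda>n. F n x) \<longlonglongrightarrow> T x"
  shows "T \<in> M"
proof -
  have "openin (pullback_topology UNIV blinfun_apply euclidean) (UNIV - M)"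
    using strongly_closed
    by (simp add: closedin_def strong_operator_topology_topspace flip: strong_operator_topology_def)
  then obtain U :: "('h \<Rightarrow> 'h) set" where "openin euclidean U" and UM: "UNIV - M = blinfun_apply -` U \<inter> UNIV"
    unfolding openin_pullback_topology by (elim exE conjE)
  then have U: "open U" by (simp only: open_openin)
  have "limitin (product_topology (\<lambda>_. euclidean) UNIV) (\<lambda>n. blinfun_apply (F n)) (blinfun_apply T) sequentially"
    unfolding limitin_componentwise using assms(2) by simp
  then have lim: "(\<lambda>n. blinfun_apply (F n)) \<longlonglongrightarrow> blinfun_apply T"
    by (simp only: euclidean_product_topology limitin_canonical_iff)
  show ?thesis
  proof (rule ccontr)
    assume "T \<notin> M"
    then have "blinfun_apply T \<in> U" using UM by blast
    then have "\<forall>\<^sub>F n in sequentially. blinfun_apply (F n) \<in> U"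
      using lim U by (simp add: tendsto_def)
    then obtain n where "blinfun_apply (F n) \<in> U" by (meson eventually_sequentially order_refl)
    then show False using assms(1) UM by blast
  qed
qed

lemma limit_mem: "(\<And>n::nat. F n \<in> M) \<Longrightarrow> F \<longlonglongrightarrow> T \<Longrightarrow> T \<in> M"
  by (rule strong_limit_mem[of F])
    (auto intro: bounded_bilinear.tendsto[OF bounded_bilinear_blinfun_apply _ tendsto_const])

lemma closed: "closed M"
  by (auto simp: closed_sequential_limits intro: limit_mem)

text \<open>For \<open>R = 1 - T / c\<close> the iteration yields \<open>(1 - Y)^2 = T / c\<close>.
  All iterates are polynomials in \<open>R\<close>, so they stay in \<open>M\<close>, and whatever
  commutes with \<open>T\<close> commutes with their limit.\<close>

lemma sqrt_exists:
  assumes T: "T \<in> M" "psd T"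
  obtains S where "S \<in> M" "psd S" "S o\<^sub>L S = T" "\<And>C. C o\<^sub>L T = T o\<^sub>L C \<Longrightarrow> C o\<^sub>L S = S o\<^sub>L C"
proof -
  define c where "c = norm T + 1"
  have c: "c > 0" by (simp add: c_def add_nonneg_pos)
  define R where "R = id_blinfun - (1/c) *\<^sub>R T"
  have R: "R \<in> M" using T by (auto simp: R_def)
  have sR: "symmetric_op R"
    unfolding R_def
    by (rule symmetric_op_diff[OF symmetric_op_id symmetric_op_scaleR[OF psd_symmetric[OF T(2)]]])
  have TcR: "T = c *\<^sub>R (id_blinfun - R)" using c by (simp add: R_def)
  have "norm ((1/c) *\<^sub>R T) \<le> 1" using c by (simp add: c_def)
  then have "psd R"
    using psd_diff_scaled_id[OF symmetric_op_scaleR[OF psd_symmetric[OF T(2)]], of "1/c" 1]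
    by (simp add: R_def)
  moreover have "inner x (R x) \<le> 1 * (norm x)\<^sup>2" for x
    using mult_nonneg_nonneg[OF _ psd_nonneg[OF T(2), of x], of "1/c"] c
    by (simp add: R_def blinfun.diff_left blinfun.scaleR_left inner_diff_right power2_norm_eq_inner)
  ultimately have nR: "norm R \<le> 1" by (rule psd_norm_le) simp
  obtain Y where Y: "sqrt_iter R \<longlonglongrightarrow> Y"
    using sqrt_iter_convergent[OF nR] by (auto simp: convergent_def)
  note Y' = sqrt_iter_limit[OF nR Y]
  have mem: "sqrt_iter R n \<in> M" for n by (induction n) (auto intro: R)
  have sym: "symmetric_op (sqrt_iter R n)" for n
    by (induction n) (auto intro!: symmetric_op_scaleR symmetric_op_add symmetric_op_square sR)
  define S where "S = sqrt c *\<^sub>R (id_blinfun - Y)"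
  have "S \<in> M" unfolding S_def using limit_mem[OF mem Y] by auto
  moreover have "psd S"
    unfolding S_def using psd_diff_scaled_id[OF symmetric_op_limit[OF Y sym] Y'(1)] c
    by (auto intro: psd_scaleR)
  moreover have "S o\<^sub>L S = T"
  proof -
    have "2 *\<^sub>R Y = R + (Y o\<^sub>L Y)" using arg_cong[OF Y'(2), of "(*\<^sub>R) 2"] by simp
    then have "R = 2 *\<^sub>R Y - (Y o\<^sub>L Y)" by (simp add: algebra_simps)
    then have "id_blinfun - R = (id_blinfun - Y) o\<^sub>L (id_blinfun - Y)"
      by (simp add: blinfun_compose_distrib scaleR_2)
    then show ?thesis
      using c by (simp add: S_def TcR bounded_bilinear.scaleR_left[OF bounded_bilinear_blinfun_compose]
          bounded_bilinear.scaleR_right[OF bounded_bilinear_blinfun_compose])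
  qed
  moreover have "C o\<^sub>L S = S o\<^sub>L C" if "C o\<^sub>L T = T o\<^sub>L C" for C
  proof -
    have CR: "C o\<^sub>L R = R o\<^sub>L C" using that by (simp add: R_def blinfun_compose_distrib)
    have "C o\<^sub>L sqrt_iter R n = sqrt_iter R n o\<^sub>L C" for n
    proof (induction n)
      case (Suc n)
      have "C o\<^sub>L (sqrt_iter R n o\<^sub>L sqrt_iter R n) = (sqrt_iter R n o\<^sub>L sqrt_iter R n) o\<^sub>L C"
        by (simp add: Suc blinfun_compose_assoc[symmetric])
          (simp add: Suc blinfun_compose_assoc)
      then show ?case by (simp add: blinfun_compose_distrib CR)
    qed simp
    then show ?thesis
      using commute_limit[OF Y] by (simp add: S_def blinfun_compose_distrib)
  qed
  ultimately show ?thesis by (rule that)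
qed

section \<open>Positive invertible elements and the Riccati equation\<close>

lemma le_op_iff_psd: "A \<in> M \<Longrightarrow> B \<in> M \<Longrightarrow> le_op A B \<longleftrightarrow> psd (B - A)"
  by (simp add: le_op_def positive_op_iff_psd diff_mem)

lemma pos_inv_mem: "A \<in> pos_inv M \<Longrightarrow> A \<in> M"
  by (simp add: pos_inv_def)

lemma pos_inv_psd: "A \<in> pos_inv M \<Longrightarrow> psd A"
  by (auto simp: pos_inv_def positive_op_iff)

text \<open>The lower bound makes \<open>R = 1 - T / c\<close> a strict contraction. Banach's fixed
  point theorem in the complete set \<open>M\<close>, applied to \<open>V -> 1 + R V\<close> and
  \<open>U -> 1 + U R\<close>, gives a right and a left inverse of \<open>T / c\<close> inside
  \<open>M\<close>.\<close>

lemma pos_invI: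
  assumes T: "T \<in> M" "psd T" and \<delta>: "\<delta> > 0" "\<And>x. \<delta> * (norm x)\<^sup>2 \<le> inner x (T x)"
  shows "T \<in> pos_inv M"
proof -
  define c where "c = norm T + \<delta>"
  have c: "c > 0" using \<delta> by (simp add: c_def add_nonneg_pos)
  define R where "R = id_blinfun - (1/c) *\<^sub>R T"
  have RM: "R \<in> M" using T by (auto simp: R_def)
  have "norm ((1/c) *\<^sub>R T) \<le> 1" using c \<delta> by (simp add: c_def)
  then have "psd R"
    using psd_diff_scaled_id[OF symmetric_op_scaleR[OF psd_symmetric[OF T(2)]], of "1/c" 1]
    by (simp add: R_def)
  moreover have "inner x (R x) \<le> (1 - \<delta> / c) * (norm x)\<^sup>2" for x
  proof -
    have "(1/c) * (\<delta> * (norm x)\<^sup>2) \<le> (1/c) * inner x (T x)"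
      using \<delta>(2)[of x] c by (intro mult_left_mono) auto
    then show ?thesis
      by (simp add: R_def blinfun.diff_left blinfun.scaleR_left inner_diff_right
          power2_norm_eq_inner left_diff_distrib)
  qed
  moreover have k: "0 \<le> 1 - \<delta> / c" "1 - \<delta> / c < 1" using c \<delta> by (simp_all add: c_def)
  ultimately have nR: "norm R \<le> 1 - \<delta> / c" by (intro psd_norm_le)
  have complete: "complete M" by (simp add: closed complete_eq_closed)
  have "dist (id_blinfun + (R o\<^sub>L S)) (id_blinfun + (R o\<^sub>L S')) \<le> (1 - \<delta> / c) * dist S S'" for S S'
  proof -
    have "dist (id_blinfun + (R o\<^sub>L S)) (id_blinfun + (R o\<^sub>L S')) = norm (R o\<^sub>L (S - S'))"
      by (simp add: dist_norm blinfun_compose_distrib)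
    also have "\<dots> \<le> norm R * norm (S - S')" by (rule norm_blinfun_compose)
    also have "\<dots> \<le> (1 - \<delta> / c) * norm (S - S')" by (intro mult_right_mono nR) simp
    finally show ?thesis by (simp add: dist_norm)
  qed
  then have "\<exists>!S. S \<in> M \<and> id_blinfun + (R o\<^sub>L S) = S"
    by (intro Banach_fix[OF complete _ k]) (auto intro: RM)
  then obtain V where V: "V \<in> M" "id_blinfun + (R o\<^sub>L V) = V" by blast
  have "dist (id_blinfun + (S o\<^sub>L R)) (id_blinfun + (S' o\<^sub>L R)) \<le> (1 - \<delta> / c) * dist S S'" for S S'
  proof -
    have "dist (id_blinfun + (S o\<^sub>L R)) (id_blinfun + (S' o\<^sub>L R)) = norm ((S - S') o\<^sub>L R)"
      by (simp add: dist_norm blinfun_compose_distrib)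
    also have "\<dots> \<le> norm (S - S') * norm R" by (rule norm_blinfun_compose)
    also have "\<dots> \<le> norm (S - S') * (1 - \<delta> / c)" by (intro mult_left_mono nR) simp
    finally show ?thesis by (simp add: dist_norm mult.commute)
  qed
  then have "\<exists>!S. S \<in> M \<and> id_blinfun + (S o\<^sub>L R) = S"
    by (intro Banach_fix[OF complete _ k]) (auto intro: RM)
  then obtain U where U: "U \<in> M" "id_blinfun + (U o\<^sub>L R) = U" by blast
  have "is_inverse_op T ((1/c) *\<^sub>R V)"
  proof (rule is_inverse_opI)
    show "((1/c) *\<^sub>R U) o\<^sub>L T = id_blinfun"
      using U(2) by (simp add: R_def blinfun_compose_distrib)
    show "T o\<^sub>L ((1/c) *\<^sub>R V) = id_blinfun"
      using V(2) by (simp add: R_def blinfun_compose_distrib)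
  qed
  moreover have "(1/c) *\<^sub>R V \<in> M" using V by blast
  ultimately show ?thesis using T by (auto simp: pos_inv_def positive_op_iff_psd)
qed

text \<open>If \<open>S\<close> inverts \<open>A = a a\<close>, then \<open>S a\<close> is a left
  inverse and \<open>a S\<close> a right inverse of \<open>a\<close>.\<close>

lemma pos_inv_sqrt:
  assumes "A \<in> pos_inv M"
  obtains a b where "a \<in> M" "psd a" "a o\<^sub>L a = A" "b \<in> M" "psd b" "is_inverse_op a b"
proof -
  obtain a where a: "a \<in> M" "psd a" "a o\<^sub>L a = A"
    using sqrt_exists[OF pos_inv_mem[OF assms] pos_inv_psd[OF assms]] by metis
  obtain S where S: "S \<in> M" "S o\<^sub>L A = id_blinfun" "A o\<^sub>L S = id_blinfun"
    using assms by (auto simp: pos_inv_def is_inverse_op_def)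
  have inv: "is_inverse_op a (a o\<^sub>L S)"
  proof (rule is_inverse_opI)
    show "(S o\<^sub>L a) o\<^sub>L a = id_blinfun" by (simp only: blinfun_compose_assoc a S)
    show "a o\<^sub>L (a o\<^sub>L S) = id_blinfun" by (simp only: blinfun_compose_assoc[symmetric] a S)
  qed
  show ?thesis
    by (rule that[OF a compose_mem[OF a(1) S(1)] psd_inverse[OF a(2) inv] inv])
qed

lemma wasserstein_mean_eq:
  assumes "A \<in> pos_inv M" "G \<in> M" "psd G"
  shows "wasserstein_mean A (G o\<^sub>L A o\<^sub>L G) =
    (1/4) *\<^sub>R ((id_blinfun + G) o\<^sub>L A o\<^sub>L (id_blinfun + G))"
proof -
  obtain a b where "a \<in> M" "psd a" "a o\<^sub>L a = A" "b \<in> M" "psd b" "is_inverse_op a b"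
    using pos_inv_sqrt[OF assms(1)] .
  then show ?thesis
    using assms by (intro wasserstein_mean_Riccati[of a b G A]) (auto simp: positive_op_iff_psd clinear)
qed

text \<open>With \<open>b\<close> inverse to \<open>a\<close>, the solution is \<open>b s b\<close>,
  where \<open>s\<close> is the positive root of \<open>a X a\<close>: this is the defining formula
  of the geometric mean.\<close>

lemma Riccati_exists:
  assumes "A \<in> pos_inv M" "X \<in> M" "psd X"
  obtains G where "G \<in> M" "psd G" "G o\<^sub>L A o\<^sub>L G = X"
proof -
  obtain a b where a: "a \<in> M" "psd a" "a o\<^sub>L a = A" and b: "b \<in> M" "psd b" "is_inverse_op a b"
    using pos_inv_sqrt[OF assms(1)] .
  have "psd (a o\<^sub>L X o\<^sub>L a)" using assms a by (auto intro: psd_conj psd_symmetric)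
  then obtain s where s: "s \<in> M" "psd s" "s o\<^sub>L s = a o\<^sub>L X o\<^sub>L a"
    using assms a by (metis compose_mem sqrt_exists)
  have ab: "a (b x) = x" and ba: "b (a x) = x" for x
    using b(3) by (simp_all add: is_inverse_op_def compose_left_cong)
  show ?thesis
  proof (rule that[of "b o\<^sub>L s o\<^sub>L b"])
    show "(b o\<^sub>L s o\<^sub>L b) o\<^sub>L A o\<^sub>L (b o\<^sub>L s o\<^sub>L b) = X"
      by (rule blinfun_eqI) (simp add: a(3)[symmetric] ab ba compose_left_cong[OF s(3)])
  qed (use b s in \<open>auto intro: psd_conj psd_symmetric\<close>)
qed

text \<open>The root \<open>s\<close> of \<open>P\<close> also commutes with \<open>Q\<close>, so
  the product equals \<open>s Q s\<close>.\<close>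

lemma psd_compose_commuting:
  assumes "P \<in> M" "psd P" "psd Q" "P o\<^sub>L Q = Q o\<^sub>L P"
  shows "psd (P o\<^sub>L Q)"
proof -
  obtain s where s: "psd s" "s o\<^sub>L s = P" "Q o\<^sub>L s = s o\<^sub>L Q"
    using sqrt_exists[OF assms(1,2)] assms(4) by metis
  have "P o\<^sub>L Q = s o\<^sub>L Q o\<^sub>L s"
    unfolding s(2)[symmetric] blinfun_compose_assoc s(3) ..
  then show ?thesis using psd_conj[OF assms(3) psd_symmetric[OF s(1)]] by simp
qed

section \<open>The commutative case\<close>

lemma norm_wasserstein_mean_commutative:
  assumes comm: "commutative_algebra M" and A: "A \<in> pos_inv M"
    and a: "a \<in> M" "psd a" "a o\<^sub>L a = A" and x: "x \<in> M" "psd x"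
  shows "norm (wasserstein_mean A (x o\<^sub>L x)) = (1/4) * (norm (a + x))\<^sup>2"
proof -
  obtain a' b where a': "psd a'" "a' o\<^sub>L a' = A" and b: "b \<in> M" "psd b" "is_inverse_op a' b"
    using pos_inv_sqrt[OF A] .
  have "a' = a" using psd_sqrt_unique[of a' a] a a' by simp
  then have ab: "a (b y) = y" and ba: "b (a y) = y" for y
    using b(3) by (simp_all add: is_inverse_op_def compose_left_cong)
  have ax: "a (x y) = x (a y)" and bx: "b (x y) = x (b y)" for y
    using comm a x b unfolding commutative_algebra_def by (metis blinfun_apply_blinfun_compose)+
  have "psd (b o\<^sub>L x)"
    using comm b x by (intro psd_compose_commuting) (auto simp: commutative_algebra_def)
  \<comment> \<open>In the commutative case the Riccati solution is the quotient \<open>b x\<close>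
    of the two square roots.\<close>
  then have "wasserstein_mean A ((b o\<^sub>L x) o\<^sub>L A o\<^sub>L (b o\<^sub>L x)) =
      (1/4) *\<^sub>R ((id_blinfun + (b o\<^sub>L x)) o\<^sub>L A o\<^sub>L (id_blinfun + (b o\<^sub>L x)))"
    using A b x by (intro wasserstein_mean_eq) auto
  also have "(b o\<^sub>L x) o\<^sub>L A o\<^sub>L (b o\<^sub>L x) = x o\<^sub>L x"
    by (rule blinfun_eqI) (simp add: a(3)[symmetric] ab ba ax bx)
  also have "(id_blinfun + (b o\<^sub>L x)) o\<^sub>L A o\<^sub>L (id_blinfun + (b o\<^sub>L x)) = (a + x) o\<^sub>L (a + x)"
    by (rule blinfun_eqI)
      (simp add: a(3)[symmetric] ab ba bx ax blinfun.add_left blinfun.add_right)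
  finally show ?thesis
    using a x by (simp add: norm_square_symmetric symmetric_op_add psd_symmetric)
qed

lemma order_determining_if_commutative:
  assumes comm: "commutative_algebra M"
  shows "order_determining M wasserstein_mean"
  unfolding order_determining_def
proof (intro ballI iffI)
  fix A B assume AB: "A \<in> pos_inv M" "B \<in> pos_inv M"
  note mem = AB[THEN pos_inv_mem] and psd = AB[THEN pos_inv_psd]
  obtain a where a: "a \<in> M" "psd a" "a o\<^sub>L a = A" using sqrt_exists[OF mem(1) psd(1)] by metis
  obtain b where b: "b \<in> M" "psd b" "b o\<^sub>L b = B" using sqrt_exists[OF mem(2) psd(2)] by metis
  {
    fix X assume le: "le_op A B" and X: "X \<in> pos_inv M"
    obtain x where x: "x \<in> M" "psd x" "x o\<^sub>L x = X"
      using sqrt_exists[OF pos_inv_mem[OF X] pos_inv_psd[OF X]] by metis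
    have "psd ((b o\<^sub>L b) - (a o\<^sub>L a))"
      unfolding a b using le le_op_iff_psd[OF mem] by blast
    then have "psd (b - a)"
      by (rule psd_diff_of_square_le[OF psd_symmetric[OF a(2)] b(2)])
    have "norm (a + x) \<le> norm (b + x)"
    proof (rule psd_norm_le)
      show "inner y ((a + x) y) \<le> norm (b + x) * (norm y)\<^sup>2" for y
        using psd_nonneg[OF \<open>psd (b - a)\<close>, of y] inner_apply_le[of y "b + x"]
        by (simp add: blinfun.add_left blinfun.diff_left inner_add_right inner_diff_right)
    qed (use a x in \<open>auto intro: psd_add\<close>)
    then have "(norm (a + x))\<^sup>2 \<le> (norm (b + x))\<^sup>2" by (rule power_mono) simp
    then show "norm (wasserstein_mean A X) \<le> norm (wasserstein_mean B X)"
      unfolding x(3)[symmetric] norm_wasserstein_mean_commutative[OF comm AB(1) a x(1,2)]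
        norm_wasserstein_mean_commutative[OF comm AB(2) b x(1,2)]
      by (rule mult_left_mono) simp
  next
    assume le: "\<forall>X\<in>pos_inv M. norm (wasserstein_mean A X) \<le> norm (wasserstein_mean B X)"
    \<comment> \<open>The summand 1 ensures \<open>x \<ge> 1\<close>, which makes \<open>x x\<close>
      invertible.\<close>
    define c where "c = norm b + 1"
    define x where "x = c *\<^sub>R id_blinfun - b"
    have xM: "x \<in> M" unfolding x_def by (intro diff_mem scaleR_mem id_mem b(1))
    have xid: "psd (x - id_blinfun)"
      using psd_diff_scaled_id[of b "norm b"] b
      by (simp add: x_def c_def psd_symmetric scaleR_add_left)
    then have x: "psd x" using psd_add[of "x - id_blinfun" id_blinfun] by simp
    have "x o\<^sub>L x \<in> pos_inv M"
    proof (rule pos_invI[of _ 1])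
      fix y
      have "norm y * norm y \<le> inner y (x y)"
        using psd_nonneg[OF xid, of y]
        by (simp add: blinfun.diff_left inner_diff_right power2_norm_eq_inner flip: power2_eq_square)
      also have "\<dots> \<le> norm y * norm (x y)" by (rule norm_cauchy_schwarz)
      finally have "norm y \<le> norm (x y)" by (cases "y = 0") auto
      then have "(norm y)\<^sup>2 \<le> (norm (x y))\<^sup>2" by (intro power_mono) auto
      then show "1 * (norm y)\<^sup>2 \<le> inner y ((x o\<^sub>L x) y)"
        by (simp add: power2_norm_eq_inner symmetric_opD[OF psd_symmetric[OF x]])
    qed (use xM x in \<open>auto intro: psd_square psd_symmetric\<close>)
    then have "(norm (a + x))\<^sup>2 \<le> (norm (b + x))\<^sup>2"
      using bspec[OF le, of "x o\<^sub>L x"] norm_wasserstein_mean_commutative[OF comm AB(1) a xM x]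
        norm_wasserstein_mean_commutative[OF comm AB(2) b xM x] by simp
    then have "norm (a + x) \<le> norm (b + x)" by (rule power2_le_imp_le) simp
    \<comment> \<open>As \<open>b + x\<close> is a scalar, the norm inequality becomes the operator
      inequality \<open>a + x \<le> c\<close>, that is \<open>a \<le> b\<close>.\<close>
    also have "b + x = c *\<^sub>R id_blinfun" by (simp add: x_def)
    also have "norm \<dots> \<le> c" using mult_left_mono[OF norm_blinfun_id_le, of c] by (simp add: c_def)
    finally have "psd (c *\<^sub>R id_blinfun - (a + x))"
      by (rule psd_diff_scaled_id[OF symmetric_op_add[OF a(2)[THEN psd_symmetric] x[THEN psd_symmetric]]])
    then have "psd (b - a)" by (simp add: x_def)
    \<comment> \<open>To pass from roots to squares, \<open>B - A\<close> is written as a product of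
      commuting positive operators.\<close>
    moreover have "psd (b + a)" by (rule psd_add[OF b(2) a(2)])
    moreover have ab: "a o\<^sub>L b = b o\<^sub>L a" using comm a b by (simp add: commutative_algebra_def)
    then have "(b - a) o\<^sub>L (b + a) = (b + a) o\<^sub>L (b - a)"
      by (simp add: blinfun_compose_distrib)
    ultimately have "psd ((b - a) o\<^sub>L (b + a))"
      by (intro psd_compose_commuting diff_mem a(1) b(1))
    also have "(b - a) o\<^sub>L (b + a) = B - A"
      by (simp add: blinfun_compose_distrib a b ab)
    finally show "le_op A B" using mem by (simp add: le_op_iff_psd)
  }
qed

text \<open>The powers of \<open>S\<close> converge strongly to the projection onto the fixed space
  of \<open>S\<close>, that is, onto the kernel of \<open>1 - S\<close>. Convergence is read off
  from the scalars \<open>q x n\<close>, which decrease and are bounded below.\<close>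

lemma kernel_projection:
  assumes S: "S \<in> M" "psd S" "psd (id_blinfun - S)"
  obtains P where "P \<in> M" "symmetric_op P" "\<And>x. S (P x) = P x" "\<And>x. S x = x \<Longrightarrow> P x = x"
proof -
  define f where "f n x = ((blinfun_apply S) ^^ n) x" for n x
  define F where "F n = (((o\<^sub>L) S) ^^ n) id_blinfun" for n
  have FM: "F n \<in> M" for n by (induction n) (auto simp: F_def intro: S)
  have Ff: "F n x = f n x" for n x by (induction n arbitrary: x) (auto simp: F_def f_def)
  have f_Suc: "f (Suc n) x = S (f n x)" for n x by (simp add: f_def)
  have inner_f: "inner (f m x) (f n y) = inner x (f (m + n) y)" for m n x y
  proof (induction m arbitrary: n)
    case (Suc m)
    have "inner (f (Suc m) x) (f n y) = inner (f m x) (f (Suc n) y)"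
      using S(2) by (simp add: f_Suc psd_symmetric symmetric_opD)
    then show ?case using Suc[of "Suc n"] by simp
  qed (simp add: f_def)
  have S_le: "inner y (S y) \<le> (norm y)\<^sup>2" for y
    using psd_nonneg[OF S(3), of y] by (simp add: blinfun.diff_left inner_diff_right power2_norm_eq_inner)
  have "norm S \<le> 1" using S_le by (intro psd_norm_le[OF S(2)]) auto
  have S_norm: "(norm (S y))\<^sup>2 \<le> inner y (S y)" for y
  proof -
    have "(norm (S y))\<^sup>2 \<le> norm S * inner y (S y)" by (rule psd_norm_apply[OF S(2)])
    also have "\<dots> \<le> 1 * inner y (S y)"
      by (intro mult_right_mono \<open>norm S \<le> 1\<close> psd_nonneg[OF S(2)])
    finally show ?thesis by simp
  qed
  define q where "q x n = inner x (f n x)" for x n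
  have q_even: "q x (k + k) = (norm (f k x))\<^sup>2" for x k
    by (simp add: q_def power2_norm_eq_inner inner_f)
  have q_odd: "q x (Suc (k + k)) = inner (f k x) (S (f k x))" for x k
    using inner_f[of k x "Suc k" x] by (simp add: q_def f_Suc)
  \<comment> \<open>Even steps use \<open>S \<le> 1\<close>, odd steps use
    \<open>S S \<le> S\<close>, both at the vector \<open>f k x\<close>.\<close>
  have q_dec: "q x (Suc n) \<le> q x n" for x n
  proof (cases "even n")
    case True
    then obtain k where "n = k + k" by (auto elim: evenE simp: mult_2)
    then show ?thesis using S_le[of "f k x"] by (simp only: q_even q_odd)
  next
    case False
    then obtain k where n: "n = Suc (k + k)" by (auto elim: oddE simp: mult_2)
    then have "Suc n = Suc k + Suc k" by simp
    then show ?thesis using S_norm[of "f k x"] by (simp only: q_even n q_odd f_Suc)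
  qed
  have q_anti: "decseq (q x)" for x by (intro decseq_SucI q_dec)
  have q_nonneg: "0 \<le> q x n" for x n
    using decseqD[OF q_anti, of n "n + n" x] by (simp add: q_even) (metis order_trans zero_le_power2)
  have q_Cauchy: "Cauchy (q x)" for x
  proof -
    have "\<forall>n. 0 \<le> q x n" by (simp add: q_nonneg)
    with q_anti[of x] show ?thesis
      by (rule decseq_convergent) (rule LIMSEQ_imp_Cauchy)
  qed
  have f_diff: "(norm (f m x - f n x))\<^sup>2 = q x (m + m) + q x (n + n) - 2 * q x (m + n)" for m n x
    by (simp add: power2_norm_eq_inner inner_diff_left inner_diff_right inner_f q_def add.commute[of n m])
  have "Cauchy (\<lambda>n. f n x)" for x
  proof (rule metric_CauchyI)
    fix e :: real assume "0 < e"
    then have "0 < e\<^sup>2 / 2" by simp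
    then obtain N where N: "\<forall>m\<ge>N. \<forall>n\<ge>N. dist (q x m) (q x n) < e\<^sup>2 / 2"
      using metric_CauchyD[OF q_Cauchy] by blast
    have "dist (f m x) (f n x) < e" if "N \<le> m" "N \<le> n" for m n
    proof -
      have "\<bar>q x (m + m) - q x (m + n)\<bar> < e\<^sup>2 / 2" "\<bar>q x (n + n) - q x (m + n)\<bar> < e\<^sup>2 / 2"
        using N[rule_format, of "m + m" "m + n"] N[rule_format, of "n + n" "m + n"] that
        by (simp_all add: dist_real_def)
      then have "(norm (f m x - f n x))\<^sup>2 < e\<^sup>2" unfolding f_diff by linarith
      then show ?thesis using \<open>0 < e\<close> by (simp add: dist_norm power2_less_imp_less)
    qed
    then show "\<exists>N. \<forall>m\<ge>N. \<forall>n\<ge>N. dist (f m x) (f n x) < e" by blast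
  qed
  then have "\<forall>x. \<exists>l. (\<lambda>n. f n x) \<longlonglongrightarrow> l"
    using Cauchy_convergent by (auto simp: convergent_def)
  then obtain p where p: "\<And>x. (\<lambda>n. f n x) \<longlonglongrightarrow> p x" by metis
  have f_norm: "norm (f n x) \<le> norm x" for n x
  proof -
    have "q x (n + n) \<le> q x 0" by (rule decseqD[OF q_anti]) simp
    then have "(norm (f n x))\<^sup>2 \<le> (norm x)\<^sup>2"
      unfolding q_even by (simp add: q_def f_def power2_norm_eq_inner)
    then show ?thesis by (rule power2_le_imp_le) simp
  qed
  have "bounded_linear p"
  proof (rule bounded_linear_intro[where K = 1])
    fix x y r
    have "(\<lambda>n. f n (x + y)) \<longlonglongrightarrow> p x + p y"
      unfolding Ff[symmetric] blinfun.add_right unfolding Ff by (intro tendsto_add p)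
    then show "p (x + y) = p x + p y" using LIMSEQ_unique[OF p] by blast
    have "(\<lambda>n. f n (r *\<^sub>R x)) \<longlonglongrightarrow> r *\<^sub>R p x"
      unfolding Ff[symmetric] blinfun.scaleR_right unfolding Ff by (intro tendsto_scaleR tendsto_const p)
    then show "p (r *\<^sub>R x) = r *\<^sub>R p x" using LIMSEQ_unique[OF p] by blast
    show "norm (p x) \<le> norm x * 1"
      using Lim_bounded[OF tendsto_norm[OF p]] f_norm by auto
  qed
  then obtain P where P: "\<And>x. blinfun_apply P x = p x" by (metis bounded_linear_Blinfun_apply)
  show ?thesis
  proof
    show "P \<in> M" by (rule strong_limit_mem[of F P, OF FM]) (simp add: Ff P p)
    show "symmetric_op P"
      unfolding symmetric_op_def
    proof (intro allI)
      fix x y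
      have "(\<lambda>n. inner (f n x) y) \<longlonglongrightarrow> inner (P x) y" "(\<lambda>n. inner x (f n y)) \<longlonglongrightarrow> inner x (P y)"
        unfolding P by (intro tendsto_inner tendsto_const p)+
      moreover have "inner (f n x) y = inner x (f n y)" for n
        using inner_f[of n x 0 y] by (simp add: f_def)
      ultimately show "inner (P x) y = inner x (P y)" by (auto intro: LIMSEQ_unique)
    qed
    show "S (P x) = P x" for x
    proof (rule LIMSEQ_unique)
      show "(\<lambda>n. S (f n x)) \<longlonglongrightarrow> S (P x)"
        unfolding P by (intro bounded_bilinear.tendsto[OF bounded_bilinear_blinfun_apply] tendsto_const p)
      show "(\<lambda>n. S (f n x)) \<longlonglongrightarrow> P x"
        unfolding P f_Suc[symmetric] by (rule LIMSEQ_Suc[OF p])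
    qed
    show "P x = x" if "S x = x" for x
    proof -
      have "f n x = x" for n by (induction n) (simp_all add: f_Suc that, simp add: f_def)
      then show ?thesis using p[of x] P by (simp add: LIMSEQ_const_iff)
    qed
  qed
qed

section \<open>Spectral projections\<close>

text \<open>\<open>E\<close> is a first binary digit of \<open>T\<close> and \<open>2 T - E\<close>
  the remainder. With \<open>Sp\<close> and \<open>Sm\<close> the positive and negative parts of
  \<open>2 T - 1\<close>, \<open>E\<close> is the complement of the projection onto the kernel of
  \<open>Sp\<close>.\<close>

lemma spectral_projection:
  assumes T: "T \<in> M" "psd T" "psd (id_blinfun - T)"
  obtains E where "E \<in> M" "symmetric_op E" "E o\<^sub>L E = E"
    "psd (2 *\<^sub>R T - E)" "psd (id_blinfun - (2 *\<^sub>R T - E))"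
proof -
  let ?I = "id_blinfun :: 'h \<Rightarrow>\<^sub>L 'h"
  define D where "D = 2 *\<^sub>R T - ?I"
  have D: "D \<in> M" "symmetric_op D"
    using T by (auto simp: D_def intro!: symmetric_op_diff symmetric_op_scaleR[OF psd_symmetric])
  obtain m where m: "m \<in> M" "psd m" "m o\<^sub>L m = D o\<^sub>L D"
    and comm: "\<And>C. C o\<^sub>L (D o\<^sub>L D) = (D o\<^sub>L D) o\<^sub>L C \<Longrightarrow> C o\<^sub>L m = m o\<^sub>L C"
    using sqrt_exists[OF compose_mem[OF D(1) D(1)] psd_square[OF D(2)]] by metis
  have Dm: "D o\<^sub>L m = m o\<^sub>L D" by (rule comm) (simp only: blinfun_compose_assoc)
  have mD: "psd (m - D)"
    by (rule psd_diff_of_square_le[OF D(2) m(2)]) (simp only: m(3) diff_self psd_zero)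
  have "(-1) *\<^sub>R D o\<^sub>L (-1) *\<^sub>R D = D o\<^sub>L D"
    by (rule blinfun_eqI) (simp add: blinfun.minus_left blinfun.minus_right)
  \<comment> \<open>In \<open>psd_diff_of_square_le\<close> the operator subtracted may have any
    sign, so the absolute value \<open>m\<close> dominates both \<open>D\<close> and
    \<open>-D\<close>.\<close>
  then have "psd (m - (-1) *\<^sub>R D)"
    by (intro psd_diff_of_square_le[OF symmetric_op_scaleR[OF D(2)] m(2)])
      (simp only: m(3) diff_self psd_zero)
  then have mD': "psd (m + D)" by simp
  have "psd (4 *\<^sub>R (T o\<^sub>L (?I - T)))"
    by (rule psd_scaleR[OF psd_compose_commuting[OF T]]) (simp_all add: blinfun_compose_distrib)
  also have "4 *\<^sub>R (T o\<^sub>L (?I - T)) = (?I o\<^sub>L ?I) - (m o\<^sub>L m)"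
    unfolding m(3) D_def
    by (rule blinfun_eqI) (simp add: blinfun.diff_left blinfun.diff_right blinfun.scaleR_left
        blinfun.scaleR_right algebra_simps flip: scaleR_2)
  finally have Im: "psd (?I - m)"
    by (rule psd_diff_of_square_le[OF psd_symmetric[OF m(2)] psd_id])
  define Sp where "Sp = (1/2) *\<^sub>R (m + D)"
  define Sm where "Sm = (1/2) *\<^sub>R (m - D)"
  have Sp: "Sp \<in> M" "psd Sp" and Sm: "Sm \<in> M" "psd Sm"
    unfolding Sp_def Sm_def
    by (intro scaleR_mem add_mem diff_mem m(1) D(1) psd_scaleR mD mD'; simp)+
  have DS: "D = Sp - Sm"
    by (rule blinfun_eqI) (simp add: Sp_def Sm_def blinfun.add_left blinfun.diff_left blinfun.scaleR_left
        flip: scaleR_diff_right scaleR_2)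
  have SpSm: "Sp o\<^sub>L Sm = 0"
    by (simp add: Sp_def Sm_def blinfun_compose_distrib m(3) Dm)
  have "?I - Sp = (1/2) *\<^sub>R ((?I - m) + 2 *\<^sub>R (?I - T))"
    by (simp add: Sp_def D_def algebra_simps flip: scaleR_2)
  then have ISp: "psd (?I - Sp)" using Im T by (simp add: psd_add psd_scaleR)
  have "?I - Sm = (1/2) *\<^sub>R ((?I - m) + 2 *\<^sub>R T)"
    by (simp add: Sm_def D_def algebra_simps flip: scaleR_2)
  then have ISm: "psd (?I - Sm)" using Im T by (simp add: psd_add psd_scaleR)
  \<comment> \<open>The fixed space of \<open>1 - Sp\<close> is the kernel of \<open>Sp\<close>, and
    it contains the range of \<open>Sm\<close> because \<open>Sp Sm = 0\<close>.\<close>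
  obtain P where P: "P \<in> M" "symmetric_op P" "\<And>x. (?I - Sp) (P x) = P x"
    "\<And>x. (?I - Sp) x = x \<Longrightarrow> P x = x"
    using kernel_projection[of "?I - Sp"] Sp ISp by auto
  have SpP: "Sp (P x) = 0" for x
    using P(3)[of x] by (simp add: blinfun.diff_left)
  have PP: "P (P x) = P x" for x by (rule P(4)) (rule P(3))
  have PSm: "P (Sm x) = Sm x" for x
    by (rule P(4)) (simp add: blinfun.diff_left compose_left_cong[OF SpSm])
  have SmP: "Sm (P x) = Sm x" for x
  proof -
    have "inner (Sm (P x)) y = inner (Sm x) y" for y
      using P(2) Sm(2) by (simp add: symmetric_opD psd_symmetric PSm)
    then show ?thesis by (metis inner_eq_zero_iff inner_diff_left right_minus_eq)
  qed
  have PSp: "P (Sp x) = 0" for x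
  proof -
    have "inner (P (Sp x)) y = 0" for y
      using P(2) Sp(2) by (simp add: symmetric_opD psd_symmetric SpP)
    then show ?thesis by (metis inner_eq_zero_iff)
  qed
  show ?thesis
  proof
    show "?I - P \<in> M" using P by auto
    show "symmetric_op (?I - P)" using P by (simp add: symmetric_op_diff)
    show "(?I - P) o\<^sub>L (?I - P) = ?I - P"
      by (rule blinfun_eqI) (simp add: blinfun.diff_left blinfun.diff_right PP)
    have "2 *\<^sub>R T - (?I - P) = Sp + (P o\<^sub>L (?I - Sm) o\<^sub>L P)"
    proof -
      have "2 *\<^sub>R T = ?I + Sp - Sm" using DS by (simp add: D_def algebra_simps)
      then show ?thesis
        by (auto intro!: blinfun_eqI simp: blinfun.diff_left blinfun.diff_right blinfun.add_left PP PSm SmP)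
    qed
    then show "psd (2 *\<^sub>R T - (?I - P))"
      using Sp ISm P by (simp add: psd_add psd_conj)
    have "?I - (2 *\<^sub>R T - (?I - P)) = ((?I - P) o\<^sub>L (?I - Sp) o\<^sub>L (?I - P)) + Sm"
    proof -
      have "2 *\<^sub>R T = ?I + Sp - Sm" using DS by (simp add: D_def algebra_simps)
      then show ?thesis
        by (auto intro!: blinfun_eqI simp: blinfun.diff_left blinfun.diff_right blinfun.add_left PP PSp SpP)
    qed
    then show "psd (?I - (2 *\<^sub>R T - (?I - P)))"
      using Sm ISp P by (simp add: psd_add psd_conj symmetric_op_diff)
  qed
qed

text \<open>Each step of the dyadic expansion splits off a projection, which commutes with \<open>Y\<close>, and halves
  the commutator.\<close>

lemma norm_commutator_dyadic:
  assumes comm: "\<And>E. E \<in> M \<Longrightarrow> symmetric_op E \<Longrightarrow> E o\<^sub>L E = E \<Longrightarrow> E o\<^sub>L Y = Y o\<^sub>L E"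
    and T: "T \<in> M" "psd T" "psd (id_blinfun - T)"
  shows "norm ((T o\<^sub>L Y) - (Y o\<^sub>L T)) \<le> 2 * norm Y / 2 ^ n"
  using T
proof (induction n arbitrary: T)
  case 0
  have "norm T \<le> 1"
  proof (rule psd_norm_le[OF 0(2)])
    show "inner x (T x) \<le> 1 * (norm x)\<^sup>2" for x
      using psd_nonneg[OF 0(3), of x]
      by (simp add: blinfun.diff_left inner_diff_right power2_norm_eq_inner)
  qed simp
  have "norm ((T o\<^sub>L Y) - (Y o\<^sub>L T)) \<le> norm (T o\<^sub>L Y) + norm (Y o\<^sub>L T)"
    by (rule norm_triangle_ineq4)
  also have "\<dots> \<le> norm T * norm Y + norm Y * norm T"
    by (intro add_mono norm_blinfun_compose)
  also have "\<dots> \<le> 1 * norm Y + norm Y * 1"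
    by (intro add_mono mult_mono \<open>norm T \<le> 1\<close>) auto
  finally show ?case by simp
next
  case (Suc n)
  obtain E where E: "E \<in> M" "symmetric_op E" "E o\<^sub>L E = E"
    "psd (2 *\<^sub>R T - E)" "psd (id_blinfun - (2 *\<^sub>R T - E))"
    using spectral_projection[OF Suc.prems] by metis
  let ?T = "2 *\<^sub>R T - E"
  have "norm ((?T o\<^sub>L Y) - (Y o\<^sub>L ?T)) \<le> 2 * norm Y / 2 ^ n"
    using E Suc.prems by (intro Suc.IH) auto
  also have "(?T o\<^sub>L Y) - (Y o\<^sub>L ?T) = 2 *\<^sub>R ((T o\<^sub>L Y) - (Y o\<^sub>L T))"
    using comm[OF E(1-3)] by (simp add: blinfun_compose_distrib scaleR_diff_right)
  finally have "2 * norm ((T o\<^sub>L Y) - (Y o\<^sub>L T)) \<le> 2 * norm Y / 2 ^ n" by simp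
  then show ?case by simp
qed

section \<open>From commuting projections to a commutative algebra\<close>

lemma commute_if_projections_commute:
  assumes comm: "\<And>E. E \<in> M \<Longrightarrow> symmetric_op E \<Longrightarrow> E o\<^sub>L E = E \<Longrightarrow> E o\<^sub>L Y = Y o\<^sub>L E"
    and T: "T \<in> M" "symmetric_op T"
  shows "T o\<^sub>L Y = Y o\<^sub>L T"
proof -
  let ?I = "id_blinfun :: 'h \<Rightarrow>\<^sub>L 'h"
  define c where "c = norm T + 1"
  have c: "c > 0" "norm T \<le> c" by (simp_all add: c_def add_nonneg_pos)
  \<comment> \<open>This affine change moves \<open>T\<close> between 0 and 1, where the dyadic
    bound applies for every \<open>n\<close>; commutation with \<open>Y\<close> carries back to
    \<open>T\<close>.\<close>
  define S where "S = (1 / (2 * c)) *\<^sub>R (c *\<^sub>R ?I - (-1) *\<^sub>R T)"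
  have SM: "S \<in> M" unfolding S_def by (intro scaleR_mem diff_mem id_mem T)
  have "psd (c *\<^sub>R ?I - (-1) *\<^sub>R T)"
    by (intro psd_diff_scaled_id symmetric_op_scaleR T) (simp add: c)
  then have S: "psd S" unfolding S_def using c by (intro psd_scaleR) auto
  have TS: "T = (2 * c) *\<^sub>R S - c *\<^sub>R ?I" using c by (simp add: S_def)
  have "?I - S = (1 / (2 * c)) *\<^sub>R (c *\<^sub>R ?I - T)"
  proof -
    have "(1 / (2 * c)) *\<^sub>R (c *\<^sub>R ?I - T) = (1/2) *\<^sub>R (2 *\<^sub>R ?I) - S"
      using c unfolding TS by (simp add: algebra_simps) (simp flip: scaleR_left_distrib)
    then show ?thesis by simp
  qed
  moreover have "psd (c *\<^sub>R ?I - T)" using T c by (intro psd_diff_scaled_id) auto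
  ultimately have IS: "psd (?I - S)" using c by (simp add: psd_scaleR)
  have bound: "norm ((S o\<^sub>L Y) - (Y o\<^sub>L S)) \<le> 2 * norm Y / 2 ^ n" for n
    by (rule norm_commutator_dyadic[OF comm SM S IS])
  have "(\<lambda>n. 2 * norm Y / 2 ^ n) \<longlonglongrightarrow> 0"
    by (rule LIMSEQ_divide_realpow_zero) simp
  then have "norm ((S o\<^sub>L Y) - (Y o\<^sub>L S)) \<le> 0"
    by (rule LIMSEQ_le_const) (intro exI[of _ 0] allI impI bound)
  then have "S o\<^sub>L Y = Y o\<^sub>L S" by simp
  then show ?thesis unfolding TS by (simp add: blinfun_compose_distrib)
qed

text \<open>With \<open>S\<close> the adjoint of \<open>T\<close>, both \<open>T + S\<close> and
  \<open>i (T - S)\<close> are symmetric. Complex linearity of \<open>C\<close> removes the factor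
  \<open>i\<close>, and the two relations add up to the one for \<open>T\<close>.\<close>

lemma commute_if_symmetric_commute:
  assumes C: "clinear_op C"
    and comm: "\<And>T. T \<in> M \<Longrightarrow> symmetric_op T \<Longrightarrow> T o\<^sub>L C = C o\<^sub>L T"
    and T: "T \<in> M"
  shows "T o\<^sub>L C = C o\<^sub>L T"
proof -
  obtain S where S: "S \<in> M" "is_adjoint T S" using adjoint_mem[OF T] by blast
  have TS: "inner (T x) y = inner x (S y)" for x y using S(2) by (rule is_adjoint_inner)
  have ST: "inner (S x) y = inner x (T y)" for x y using TS[of y x] by (simp add: inner_commute)
  have "symmetric_op (T + S)"
    by (simp add: symmetric_op_def blinfun.add_left inner_add_left inner_add_right TS ST)
  then have sum: "(T + S) o\<^sub>L C = C o\<^sub>L (T + S)" using T S by (intro comm) auto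
  let ?W = "scaleC_op \<i> (T - S)"
  have "symmetric_op ?W"
    unfolding symmetric_op_def
  proof (intro allI)
    fix x y
    have "inner (?W x) y = - inner ((T - S) x) (\<i> *\<^sub>C y)"
      by (simp add: scaleC_op.rep_eq inner_scaleC_i)
    also have "\<dots> = inner x ((T - S) (\<i> *\<^sub>C y))"
      by (simp add: blinfun.diff_left inner_diff_left inner_diff_right TS ST)
    also have "(T - S) (\<i> *\<^sub>C y) = ?W y"
      using T S by (simp add: scaleC_op.rep_eq clinear_op_scaleC clinear diff_mem)
    finally show "inner (?W x) y = inner x (?W y)" .
  qed
  then have W: "?W o\<^sub>L C = C o\<^sub>L ?W" using T S by (intro comm scaleC_mem) auto
  have diff: "(T - S) (C x) = C ((T - S) x)" for x
  proof -
    have "\<i> *\<^sub>C (T - S) (C x) = \<i> *\<^sub>C C ((T - S) x)"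
      using compose_left_cong[OF W, of x] C by (simp add: scaleC_op.rep_eq clinear_op_scaleC)
    then have "(-\<i>) *\<^sub>C \<i> *\<^sub>C (T - S) (C x) = (-\<i>) *\<^sub>C \<i> *\<^sub>C C ((T - S) x)" by simp
    then show ?thesis
      using scaleC_of_real[of 1 "(T - S) (C x)"] scaleC_of_real[of 1 "C ((T - S) x)"]
      by (simp only: scaleC_scaleC) simp
  qed
  show ?thesis
  proof (rule blinfun_eqI)
    fix x
    have eqs: "T (C x) + S (C x) = C (T x) + C (S x)" "T (C x) - S (C x) = C (T x) - C (S x)"
      using compose_left_cong[OF sum, of x] diff[of x]
      by (simp_all add: blinfun.add_left blinfun.add_right blinfun.diff_left blinfun.diff_right)
    have "2 *\<^sub>R T (C x) = 2 *\<^sub>R C (T x)"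
      using arg_cong2[OF eqs, of "(+)"] by (simp add: scaleR_2)
    then show "(T o\<^sub>L C) x = (C o\<^sub>L T) x" by simp
  qed
qed

text \<open>One factor is enlarged at a time: from projections to symmetric elements, then to all
  elements on the left, then to all on the right.\<close>

lemma commutative_if_projections_commute:
  assumes "\<And>E Y. E \<in> M \<Longrightarrow> symmetric_op E \<Longrightarrow> E o\<^sub>L E = E \<Longrightarrow> Y \<in> M \<Longrightarrow> symmetric_op Y \<Longrightarrow>
    E o\<^sub>L Y = Y o\<^sub>L E"
  shows "commutative_algebra M"
proof -
  have 1: "T o\<^sub>L Y = Y o\<^sub>L T" if "T \<in> M" "symmetric_op T" "Y \<in> M" "symmetric_op Y" for T Y
    by (rule commute_if_projections_commute[OF _ that(1,2)]) (rule assms[OF _ _ _ that(3,4)])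
  have 2: "T o\<^sub>L Y = Y o\<^sub>L T" if "T \<in> M" "Y \<in> M" "symmetric_op Y" for T Y
    by (rule commute_if_symmetric_commute[OF clinear[OF that(2)] 1[OF _ _ that(2,3)] that(1)])
  show ?thesis
    unfolding commutative_algebra_def
  proof (intro ballI)
    fix S T assume S: "S \<in> M" and T: "T \<in> M"
    show "S o\<^sub>L T = T o\<^sub>L S"
      by (rule commute_if_symmetric_commute[OF clinear[OF T] _ S]) (rule 2[OF T, symmetric])
  qed
qed

end

section \<open>The corner of a Riccati solution\<close>

definition orth_proj :: "('h::real_inner \<Rightarrow>\<^sub>L 'h) \<Rightarrow> bool" where
  "orth_proj p \<longleftrightarrow> symmetric_op p \<and> p o\<^sub>L p = p"

text \<open>For a projection \<open>p\<close> these operators multiply by multiplying the parameter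
  \<open>s\<close>, so their inverses and square roots are again explicit two-level
  operators.\<close>

definition two_level :: "('h::real_inner \<Rightarrow>\<^sub>L 'h) \<Rightarrow> real \<Rightarrow> ('h \<Rightarrow>\<^sub>L 'h)" where
  "two_level p s = p + s *\<^sub>R (id_blinfun - p)"

lemma two_level_apply: "two_level p s x = p x + s *\<^sub>R (x - p x)"
  by (simp add: two_level_def blinfun.add_left blinfun.scaleR_left blinfun.diff_left)

lemma orth_proj_idem: "orth_proj p \<Longrightarrow> p (p x) = p x"
  by (simp add: orth_proj_def compose_left_cong)

lemma orth_proj_symmetric: "orth_proj p \<Longrightarrow> symmetric_op p"
  by (simp add: orth_proj_def)

lemma two_level_compose:
  "orth_proj p \<Longrightarrow> two_level p s (two_level p t x) = two_level p (s * t) x"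
  by (simp add: two_level_apply blinfun.add_right blinfun.diff_right blinfun.scaleR_right orth_proj_idem)

lemma two_level_fixed: "p x = x \<Longrightarrow> two_level p s x = x"
  for p :: "'h::real_inner \<Rightarrow>\<^sub>L 'h"
  by (simp add: two_level_apply)

lemma two_level_1: "two_level p 1 x = x"
  for p :: "'h::real_inner \<Rightarrow>\<^sub>L 'h"
  by (simp add: two_level_apply)

lemma symmetric_op_two_level: "orth_proj p \<Longrightarrow> symmetric_op (two_level p s)"
  unfolding two_level_def
  by (intro symmetric_op_add symmetric_op_scaleR symmetric_op_diff symmetric_op_id orth_proj_symmetric)

lemma norm_orth_proj_split:
  assumes "orth_proj p"
  shows "(norm x)\<^sup>2 = (norm (p x))\<^sup>2 + (norm (x - p x))\<^sup>2"
proof -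
  have "inner (p x) (x - p x) = 0"
    using symmetric_opD[OF orth_proj_symmetric[OF assms], of x "x - p x"]
    by (simp add: blinfun.diff_right orth_proj_idem[OF assms])
  then show ?thesis
    by (simp add: power2_norm_eq_inner inner_diff_left inner_diff_right inner_commute)
qed

lemma inner_two_level:
  assumes "orth_proj p"
  shows "inner x (two_level p s x) = (norm (p x))\<^sup>2 + s * (norm (x - p x))\<^sup>2"
proof -
  have "inner x (p x) = (norm (p x))\<^sup>2"
    using symmetric_opD[OF orth_proj_symmetric[OF assms], of x "p x"]
    by (simp add: power2_norm_eq_inner orth_proj_idem[OF assms])
  moreover from this have "inner x (x - p x) = (norm (x - p x))\<^sup>2"
    using norm_orth_proj_split[OF assms, of x]
    by (simp add: inner_diff_right flip: power2_norm_eq_inner)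
  ultimately show ?thesis by (simp add: two_level_apply inner_add_right)
qed

lemma inner_two_level_ge:
  assumes "orth_proj p" "c \<le> s" "c \<le> 1"
  shows "c * (norm x)\<^sup>2 \<le> inner x (two_level p s x)"
  unfolding inner_two_level[OF assms(1)] norm_orth_proj_split[OF assms(1), of x] distrib_left
  using mult_right_mono[OF assms(3), of "(norm (p x))\<^sup>2"] assms(2)
  by (intro add_mono mult_right_mono) auto

lemma inner_two_level_le:
  assumes "orth_proj p" "s \<le> 1"
  shows "inner x (two_level p s x) \<le> (norm x)\<^sup>2"
  unfolding inner_two_level[OF assms(1)] norm_orth_proj_split[OF assms(1), of x]
  using mult_right_mono[OF assms(2), of "(norm (x - p x))\<^sup>2"] by simp

lemma psd_two_level: "orth_proj p \<Longrightarrow> 0 \<le> s \<Longrightarrow> psd (two_level p s)"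
  by (simp add: psd_def symmetric_op_two_level inner_two_level)

text \<open>Since \<open>B = p + b (1 - p)\<close> has a spectral gap below its top eigenvalue \<open>1\<close>, the first order term of
  \<open>\<parallel>(1 + t F) B (1 + t F)\<parallel>\<close> at \<open>t = 0\<close> only sees the corner \<open>p F p\<close>.\<close>

lemma norm_perturbed_two_level_le:
  assumes p: "orth_proj p" and b: "0 < b" "b < 1" and F: "symmetric_op F"
    and f: "\<And>y. p y = y \<Longrightarrow> inner y (F y) \<le> f * (norm y)\<^sup>2" "0 \<le> f"
  obtains C where "\<And>t. 0 \<le> t \<Longrightarrow>
    norm ((id_blinfun + t *\<^sub>R F) o\<^sub>L two_level p b o\<^sub>L (id_blinfun + t *\<^sub>R F)) \<le> 1 + 2 * t * f + C * t\<^sup>2"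
proof
  define n where "n = norm F"
  fix t :: real assume t: "0 \<le> t"
  let ?B = "two_level p b" and ?H = "id_blinfun + t *\<^sub>R F"
  have n: "0 \<le> n" by (simp add: n_def)
  have H: "symmetric_op ?H" using F by (intro symmetric_op_add symmetric_op_scaleR symmetric_op_id)
  have F_le: "inner u (F v) \<le> n * norm u * norm v" for u v
  proof -
    have "inner u (F v) \<le> norm u * norm (F v)" by (rule norm_cauchy_schwarz)
    also have "\<dots> \<le> norm u * (n * norm v)" unfolding n_def by (intro mult_left_mono norm_blinfun) simp
    finally show ?thesis by (simp add: mult_ac)
  qed
  show "norm (?H o\<^sub>L ?B o\<^sub>L ?H) \<le> 1 + 2 * t * f + (n\<^sup>2 + 9 * n\<^sup>2 / (1 - b)) * t\<^sup>2"
  proof (rule psd_norm_le)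
    show "psd (?H o\<^sub>L ?B o\<^sub>L ?H)" using p b H by (intro psd_conj psd_two_level) auto
    show "0 \<le> 1 + 2 * t * f + (n\<^sup>2 + 9 * n\<^sup>2 / (1 - b)) * t\<^sup>2" using t f(2) b by simp
    fix x
    define x1 x2 where "x1 = p x" and "x2 = x - p x"
    have x: "x = x1 + x2" by (simp add: x1_def x2_def)
    have px1: "p x1 = x1" by (simp add: x1_def orth_proj_idem[OF p])
    have nx: "(norm x)\<^sup>2 = (norm x1)\<^sup>2 + (norm x2)\<^sup>2"
      unfolding x1_def x2_def by (rule norm_orth_proj_split[OF p])
    have x1: "norm x1 \<le> norm x" and x2: "norm x2 \<le> norm x"
      using nx by (auto intro: power2_le_imp_le)
    have "inner x ((?H o\<^sub>L ?B o\<^sub>L ?H) x) = inner (x + t *\<^sub>R F x) (?B (x + t *\<^sub>R F x))"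
      using symmetric_opD[OF H] by (simp add: blinfun.add_left blinfun.scaleR_left)
    also have "\<dots> = inner x (?B x) + 2 * t * inner (F x) (?B x) + t\<^sup>2 * inner (F x) (?B (F x))"
      using symmetric_opD[OF symmetric_op_two_level[OF p], of b x "F x"]
      by (simp add: blinfun.add_right blinfun.scaleR_right inner_add_left inner_add_right
          power2_eq_square inner_commute[of "F x" "?B x"] algebra_simps)
    also have "inner x (?B x) = (norm x)\<^sup>2 - (1 - b) * (norm x2)\<^sup>2"
      unfolding inner_two_level[OF p] nx by (simp add: x1_def x2_def algebra_simps)
    also have "inner (F x) (?B x) = inner x1 (F x1) + (1 + b) * inner x1 (F x2) + b * inner x2 (F x2)"
    proof -
      have "?B x = x1 + b *\<^sub>R x2" by (simp add: two_level_apply x1_def x2_def)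
      then show ?thesis
        unfolding symmetric_opD[OF F] by (subst x)
          (simp add: blinfun.add_right blinfun.scaleR_right inner_add_left inner_add_right algebra_simps
            inner_commute[of x2 "F x1"] symmetric_opD[OF F])
    qed
    finally have eq: "inner x ((?H o\<^sub>L ?B o\<^sub>L ?H) x) = (norm x)\<^sup>2 - (1 - b) * (norm x2)\<^sup>2
      + 2 * t * (inner x1 (F x1) + (1 + b) * inner x1 (F x2) + b * inner x2 (F x2))
      + t\<^sup>2 * inner (F x) (?B (F x))" .
    have e1: "inner x1 (F x1) \<le> f * (norm x)\<^sup>2"
      using f(1)[OF px1] mult_left_mono[OF power_mono[OF x1, of 2] f(2)] by simp
    have e2: "(1 + b) * inner x1 (F x2) \<le> 2 * (n * norm x * norm x2)"
    proof -
      have "inner x1 (F x2) \<le> n * norm x1 * norm x2" by (rule F_le)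
      also have "\<dots> \<le> n * norm x * norm x2" using x1 n by (intro mult_right_mono mult_left_mono) auto
      finally have "(1 + b) * inner x1 (F x2) \<le> (1 + b) * (n * norm x * norm x2)"
        using b by (intro mult_left_mono) auto
      also have "\<dots> \<le> 2 * (n * norm x * norm x2)" using b n by (intro mult_right_mono) auto
      finally show ?thesis .
    qed
    have e3: "b * inner x2 (F x2) \<le> n * norm x * norm x2"
    proof -
      have "inner x2 (F x2) \<le> n * norm x2 * norm x2" by (rule F_le)
      also have "\<dots> \<le> n * norm x * norm x2" using x2 n by (intro mult_right_mono mult_left_mono) auto
      finally have "b * inner x2 (F x2) \<le> b * (n * norm x * norm x2)" using b by (intro mult_left_mono) auto
      also have "\<dots> \<le> 1 * (n * norm x * norm x2)" using b n by (intro mult_right_mono) auto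
      finally show ?thesis by simp
    qed
    have e4: "inner (F x) (?B (F x)) \<le> n\<^sup>2 * (norm x)\<^sup>2"
    proof -
      have "inner (F x) (?B (F x)) \<le> (norm (F x))\<^sup>2" using p b by (intro inner_two_level_le) auto
      also have "\<dots> \<le> (n * norm x)\<^sup>2" unfolding n_def by (intro power_mono norm_blinfun) simp
      finally show ?thesis by (simp add: power_mult_distrib)
    qed
    \<comment> \<open>The two mixed bounds contribute \<open>2 t (2 + 1) n\<close> times the norms
      of \<open>x\<close> and \<open>x2\<close>. Completing the square against the gap term
      \<open>1 - b\<close> absorbs them at a cost of order \<open>t^2\<close>.\<close>
    have e5: "6 * t * n * norm x * norm x2 - (1 - b) * (norm x2)\<^sup>2 \<le> 9 * n\<^sup>2 / (1 - b) * t\<^sup>2 * (norm x)\<^sup>2"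
    proof -
      have "0 \<le> (3 * t * n * norm x - (1 - b) * norm x2)\<^sup>2 / (1 - b)" using b by simp
      also have "\<dots> = 9 * n\<^sup>2 / (1 - b) * t\<^sup>2 * (norm x)\<^sup>2 - 6 * t * n * norm x * norm x2 + (1 - b) * (norm x2)\<^sup>2"
        using b by (simp add: field_simps power2_eq_square)
      finally show ?thesis by linarith
    qed
    have "2 * t * (inner x1 (F x1) + (1 + b) * inner x1 (F x2) + b * inner x2 (F x2))
        \<le> 2 * t * (f * (norm x)\<^sup>2 + 2 * (n * norm x * norm x2) + n * norm x * norm x2)"
      using e1 e2 e3 t by (intro mult_left_mono add_mono) auto
    moreover have "t\<^sup>2 * inner (F x) (?B (F x)) \<le> t\<^sup>2 * (n\<^sup>2 * (norm x)\<^sup>2)"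
      using e4 by (intro mult_left_mono) auto
    ultimately show "inner x ((?H o\<^sub>L ?B o\<^sub>L ?H) x) \<le> (1 + 2 * t * f + (n\<^sup>2 + 9 * n\<^sup>2 / (1 - b)) * t\<^sup>2) * (norm x)\<^sup>2"
      unfolding eq using e5 by (simp add: algebra_simps)
  qed
qed

lemma inner_perturbed_two_level_ge:
  assumes p: "orth_proj p" and s: "0 \<le> s" and G: "symmetric_op G" and y: "p y = y"
  shows "(norm y)\<^sup>2 + 2 * t * inner y (G y)
    \<le> inner y (((id_blinfun + t *\<^sub>R G) o\<^sub>L two_level p s o\<^sub>L (id_blinfun + t *\<^sub>R G)) y)"
proof -
  let ?A = "two_level p s" and ?H = "id_blinfun + t *\<^sub>R G"
  have H: "symmetric_op ?H" using G by (intro symmetric_op_add symmetric_op_scaleR symmetric_op_id)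
  have Ay: "?A y = y" using y by (rule two_level_fixed)
  have "inner y ((?H o\<^sub>L ?A o\<^sub>L ?H) y) = inner (y + t *\<^sub>R G y) (?A (y + t *\<^sub>R G y))"
    using symmetric_opD[OF H] by (simp add: blinfun.add_left blinfun.scaleR_left)
  also have "\<dots> = (norm y)\<^sup>2 + 2 * t * inner y (G y) + t\<^sup>2 * inner (G y) (?A (G y))"
    using symmetric_opD[OF symmetric_op_two_level[OF p], of s y "G y"]
    by (simp add: blinfun.add_right blinfun.scaleR_right inner_add_left inner_add_right Ay
        power2_eq_square[of t] inner_commute[of "G y" y] power2_norm_eq_inner algebra_simps)
  finally show ?thesis using psd_nonneg[OF psd_two_level[OF p s]] by simp
qed

section \<open>Order determination forces projections to be central\<close>

context vn_algebra
begin

lemma two_level_mem: "p \<in> M \<Longrightarrow> two_level p s \<in> M"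
  unfolding two_level_def by (intro add_mem scaleR_mem diff_mem id_mem)

lemma two_level_pos_inv:
  assumes "p \<in> M" "orth_proj p" "0 < s"
  shows "two_level p s \<in> pos_inv M"
  using assms
  by (intro pos_invI[of _ "min s 1"] two_level_mem psd_two_level inner_two_level_ge) auto

lemma conj_pos_inv:
  fixes F B :: "'h \<Rightarrow>\<^sub>L 'h"
  assumes F: "F \<in> M" "symmetric_op F" and \<delta>: "0 < \<delta>" "\<And>x. \<delta> * (norm x)\<^sup>2 \<le> inner x (F x)"
    and B: "B \<in> M" "psd B" and \<beta>: "0 < \<beta>" "\<And>x. \<beta> * (norm x)\<^sup>2 \<le> inner x (B x)"
  shows "F o\<^sub>L B o\<^sub>L F \<in> pos_inv M"
proof (rule pos_invI[of _ "\<beta> * \<delta>\<^sup>2"])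
  show "0 < \<beta> * \<delta>\<^sup>2" using \<delta> \<beta> by simp
  fix x :: 'h
  have "norm x * (\<delta> * norm x) = \<delta> * (norm x)\<^sup>2" by (simp add: power2_eq_square)
  also have "\<dots> \<le> inner x (F x)" by (rule \<delta>)
  also have "\<dots> \<le> norm x * norm (F x)" by (rule norm_cauchy_schwarz)
  finally have "\<delta> * norm x \<le> norm (F x)" by (cases "x = 0") auto
  then have "(\<delta> * norm x)\<^sup>2 \<le> (norm (F x))\<^sup>2" using \<delta> by (intro power_mono) auto
  then have "\<beta> * (\<delta> * norm x)\<^sup>2 \<le> \<beta> * (norm (F x))\<^sup>2" using \<beta> by (intro mult_left_mono) auto
  also have "\<dots> \<le> inner (F x) (B (F x))" by (rule \<beta>)
  finally show "\<beta> * \<delta>\<^sup>2 * (norm x)\<^sup>2 \<le> inner x ((F o\<^sub>L B o\<^sub>L F) x)"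
    by (simp add: symmetric_opD[OF F(2)] power_mult_distrib mult.assoc)
qed (use F B in \<open>auto intro: psd_conj\<close>)

text \<open>\<open>h\<close> is the part of an element of \<open>M\<close> that is off-diagonal with respect to \<open>p\<close>. With
  \<open>K = \<bar>h\<bar> + h\<close> one has \<open>K (p + s (1 - p)) K = (1 + s) K\<^sup>2 / 2\<close>, so that for singular \<open>X = K\<^sup>2 / 2\<close>
  the solution of the Riccati equation would be \<open>K / sqrt (1 + s)\<close>, whose corner is strictly
  decreasing in \<open>s\<close>. The values \<open>s = 9/16\<close> and \<open>s = 7/9\<close> have rational \<open>sqrt (1 + s)\<close>, and
  the term \<open>\<epsilon> B\<^sup>-\<^sup>1\<close> makes \<open>X\<close> invertible.\<close>

lemma off_diagonal_corner_le:
  assumes od: "order_determining M wasserstein_mean"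
    and p: "p \<in> M" "orth_proj p"
    and h: "h \<in> M" "symmetric_op h" "\<And>x. p (h x) = h (x - p x)"
    and m: "m \<in> M" "psd m" "m o\<^sub>L m = h o\<^sub>L h" "\<And>x. h (m x) = m (h x)" "\<And>x. p (m x) = m (p x)"
    and \<epsilon>: "0 < \<epsilon>" and \<mu>: "0 \<le> \<mu>" "\<And>y. p y = y \<Longrightarrow> inner y (m y) \<le> \<mu> * (norm y)\<^sup>2"
    and y: "p y = y"
  shows "inner y (m y) \<le> (15/16) * (\<mu> + \<epsilon>) * (norm y)\<^sup>2"
proof -
  let ?P = "two_level p"
  define A where "A = ?P (9/16)"
  define B where "B = ?P (7/9)"
  \<comment> \<open>\<open>D\<close> is the inverse of \<open>B\<close>, \<alpha> the square root of
    \<open>A\<close>, and \<beta> the inverse of \<alpha>.\<close>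
  define D where "D = ?P (9/7)"
  define \<alpha> where "\<alpha> = ?P (3/4)"
  define \<beta> where "\<beta> = ?P (4/3)"
  define K where "K = m + h"
  \<comment> \<open>The factors 4/5 and 3/4 are the reciprocals of \<open>sqrt (1 + 9/16)\<close>
    and \<open>sqrt (1 + 7/9)\<close>.\<close>
  define G0 where "G0 = (4/5) *\<^sub>R K"
  define F where "F = (3/4) *\<^sub>R (K + \<epsilon> *\<^sub>R D)"
  define X where "X = F o\<^sub>L B o\<^sub>L F"
  note defs = A_def B_def D_def \<alpha>_def \<beta>_def
  have PP: "?P s (?P t x) = ?P (s * t) x" for s t x by (rule two_level_compose[OF p(2)])
  have P1: "?P 1 x = x" for x by (rule two_level_1)
  have mm: "m (m x) = h (h x)" for x using compose_left_cong[OF m(3), of x] by simp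
  have KM: "K \<in> M" unfolding K_def by (intro add_mem m h)
  have "psd (m - (-1) *\<^sub>R h)"
  proof (rule psd_diff_of_square_le[OF symmetric_op_scaleR[OF h(2)] m(2)])
    have "(-1) *\<^sub>R h o\<^sub>L (-1) *\<^sub>R h = h o\<^sub>L h"
      by (rule blinfun_eqI) (simp add: blinfun.minus_left blinfun.minus_right)
    then show "psd ((m o\<^sub>L m) - ((-1) *\<^sub>R h o\<^sub>L (-1) *\<^sub>R h))"
      by (simp only: m(3) diff_self psd_zero)
  qed
  then have K: "psd K" by (simp add: K_def)
  have ph: "p (h x) = h x - h (p x)" for x using h(3)[of x] by (simp add: blinfun.diff_right)
  \<comment> \<open>Moving \<open>p\<close> past \<open>h\<close> turns it into
    \<open>1 - p\<close>, while \<open>p\<close> commutes with \<open>m\<close>; the contributions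
    of \<open>p\<close> and \<open>1 - p\<close> therefore combine into the factor
    \<open>1 + s\<close>.\<close>
  have KPK: "K (?P s (K x)) = (1 + s) *\<^sub>R (h (h x) + m (h x))" for s x
    by (simp add: K_def two_level_apply blinfun.add_left blinfun.add_right blinfun.diff_right
        blinfun.scaleR_right ph m(4,5) mm orth_proj_idem[OF p(2)] algebra_simps)
  have DM: "D \<in> M" "psd D" and BM: "B \<in> M" "psd B" "B \<in> pos_inv M" and AM: "A \<in> M" "psd A" "A \<in> pos_inv M"
    using p by (auto simp: defs intro: two_level_mem psd_two_level two_level_pos_inv)
  have D_ge: "1 * (norm x)\<^sup>2 \<le> inner x (D x)" for x
    unfolding D_def by (rule inner_two_level_ge[OF p(2)]) auto
  have B_ge: "(7/9) * (norm x)\<^sup>2 \<le> inner x (B x)" for x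
    unfolding B_def by (rule inner_two_level_ge[OF p(2)]) auto
  have FM: "F \<in> M" unfolding F_def by (intro scaleR_mem add_mem KM DM)
  have F: "psd F" unfolding F_def using \<epsilon> by (intro psd_scaleR psd_add K DM) auto
  have F_ge: "(3/4 * \<epsilon>) * (norm x)\<^sup>2 \<le> inner x (F x)" for x
  proof -
    have "\<epsilon> * (norm x)\<^sup>2 \<le> \<epsilon> * inner x (D x)" using D_ge[of x] \<epsilon> by (intro mult_left_mono) auto
    then have "\<epsilon> * (norm x)\<^sup>2 \<le> inner x (K x) + \<epsilon> * inner x (D x)" using psd_nonneg[OF K, of x] by linarith
    then show ?thesis
      by (simp add: F_def blinfun.add_left blinfun.scaleR_left inner_add_right)
  qed
  have XM: "X \<in> M" "psd X"
    unfolding X_def by (intro compose_mem FM BM, rule psd_conj[OF BM(2) psd_symmetric[OF F]])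
  obtain G where G: "G \<in> M" "psd G" "G o\<^sub>L A o\<^sub>L G = X"
    using Riccati_exists[OF AM(3) XM] .
  \<comment> \<open>Conjugation by \<alpha> turns the two Riccati expressions into squares, so
    taking roots and undoing it with \<beta> yields \<open>G0 \<le> G\<close>.\<close>
  have "psd (\<alpha> o\<^sub>L (X - (G0 o\<^sub>L A o\<^sub>L G0)) o\<^sub>L \<alpha>)"
  proof (rule psd_conj)
    have "X - (G0 o\<^sub>L A o\<^sub>L G0) = (9/16) *\<^sub>R ((2 * \<epsilon>) *\<^sub>R K + \<epsilon>\<^sup>2 *\<^sub>R D)"
    proof (rule blinfun_eqI)
      fix x
      have BD: "B (D x) = x" and DB: "D (B x) = x" for x
        by (simp_all add: B_def D_def PP P1)
      have "X x = (9/16) *\<^sub>R (K (B (K x)) + \<epsilon> *\<^sub>R K (B (D x)) + \<epsilon> *\<^sub>R D (B (K x)) + \<epsilon>\<^sup>2 *\<^sub>R D (B (D x)))"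
        by (simp add: X_def F_def blinfun.add_left blinfun.add_right blinfun.scaleR_left
            blinfun.scaleR_right scaleR_right_distrib power2_eq_square)
      also have "\<dots> = (9/16) *\<^sub>R (K (B (K x))) + (9/16) *\<^sub>R ((2 * \<epsilon>) *\<^sub>R K x + \<epsilon>\<^sup>2 *\<^sub>R D x)"
        unfolding BD DB by (simp add: scaleR_right_distrib flip: scaleR_left_distrib)
      also have "(9/16) *\<^sub>R (K (B (K x))) = (G0 o\<^sub>L A o\<^sub>L G0) x"
        by (simp add: G0_def A_def B_def blinfun.scaleR_left blinfun.scaleR_right KPK)
      finally show "(X - (G0 o\<^sub>L A o\<^sub>L G0)) x = ((9/16) *\<^sub>R ((2 * \<epsilon>) *\<^sub>R K + \<epsilon>\<^sup>2 *\<^sub>R D)) x"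
        by (simp add: blinfun.diff_left blinfun.add_left blinfun.scaleR_left)
    qed
    then show "psd (X - (G0 o\<^sub>L A o\<^sub>L G0))"
      using K DM \<epsilon> by (simp add: psd_add psd_scaleR)
    show "symmetric_op \<alpha>" unfolding \<alpha>_def by (rule symmetric_op_two_level[OF p(2)])
  qed
  also have "\<alpha> o\<^sub>L (X - (G0 o\<^sub>L A o\<^sub>L G0)) o\<^sub>L \<alpha> =
      ((\<alpha> o\<^sub>L G o\<^sub>L \<alpha>) o\<^sub>L (\<alpha> o\<^sub>L G o\<^sub>L \<alpha>)) - ((\<alpha> o\<^sub>L G0 o\<^sub>L \<alpha>) o\<^sub>L (\<alpha> o\<^sub>L G0 o\<^sub>L \<alpha>))"
  proof (rule blinfun_eqI)
    have \<alpha>\<alpha>: "\<alpha> (\<alpha> x) = A x" for x by (simp add: \<alpha>_def A_def PP)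
    show "(\<alpha> o\<^sub>L (X - (G0 o\<^sub>L A o\<^sub>L G0)) o\<^sub>L \<alpha>) x =
        (((\<alpha> o\<^sub>L G o\<^sub>L \<alpha>) o\<^sub>L (\<alpha> o\<^sub>L G o\<^sub>L \<alpha>)) - ((\<alpha> o\<^sub>L G0 o\<^sub>L \<alpha>) o\<^sub>L (\<alpha> o\<^sub>L G0 o\<^sub>L \<alpha>))) x" for x
      by (simp add: blinfun.diff_left blinfun.diff_right \<alpha>\<alpha> flip: G(3))
  qed
  finally have "psd ((\<alpha> o\<^sub>L G o\<^sub>L \<alpha>) - (\<alpha> o\<^sub>L G0 o\<^sub>L \<alpha>))"
    using p K G unfolding G0_def \<alpha>_def
    by (intro psd_diff_of_square_le[of "two_level p (3/4) o\<^sub>L (4/5) *\<^sub>R K o\<^sub>L two_level p (3/4)"])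
      (auto intro: symmetric_op_conj psd_conj symmetric_op_two_level symmetric_op_scaleR psd_symmetric)
  then have "psd (\<beta> o\<^sub>L ((\<alpha> o\<^sub>L G o\<^sub>L \<alpha>) - (\<alpha> o\<^sub>L G0 o\<^sub>L \<alpha>)) o\<^sub>L \<beta>)"
    by (rule psd_conj) (simp add: \<beta>_def symmetric_op_two_level p)
  also have "\<beta> o\<^sub>L ((\<alpha> o\<^sub>L G o\<^sub>L \<alpha>) - (\<alpha> o\<^sub>L G0 o\<^sub>L \<alpha>)) o\<^sub>L \<beta> = G - G0"
    by (rule blinfun_eqI) (simp add: \<alpha>_def \<beta>_def PP P1 blinfun.diff_left blinfun.diff_right)
  finally have G_ge: "inner x (G0 x) \<le> inner x (G x)" for x
    using psd_nonneg[of "G - G0" x] by (simp add: blinfun.diff_left inner_diff_right)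
  \<comment> \<open>The off-diagonal \<open>h\<close> has zero corner, so only \<open>m\<close> is
    seen on the range of \<open>p\<close>.\<close>
  have Kz: "inner z (K z) = inner z (m z)" if "p z = z" for z
  proof -
    have "inner z (h z) = inner (p z) (h z)" using that by simp
    also have "\<dots> = inner z (h (z - p z))"
      using symmetric_opD[OF orth_proj_symmetric[OF p(2)]] by (simp add: h(3))
    finally show ?thesis using that by (simp add: K_def blinfun.add_left inner_add_right)
  qed
  define f where "f = (3/4) * (\<mu> + \<epsilon>)"
  have f0: "0 \<le> f" using \<mu> \<epsilon> by (simp add: f_def)
  have f: "inner z (F z) \<le> f * (norm z)\<^sup>2" if z: "p z = z" for z
  proof -
    have "D z = z" unfolding D_def using z by (rule two_level_fixed)
    then have "inner z (F z) = (3/4) * (inner z (m z) + \<epsilon> * (norm z)\<^sup>2)"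
      by (simp add: F_def blinfun.add_left blinfun.scaleR_left inner_add_right Kz[OF z] power2_norm_eq_inner)
    also have "\<dots> \<le> (3/4) * (\<mu> * (norm z)\<^sup>2 + \<epsilon> * (norm z)\<^sup>2)"
      using \<mu>(2)[OF z] by (intro mult_left_mono add_right_mono) auto
    finally show ?thesis by (simp add: f_def algebra_simps)
  qed
  \<comment> \<open>\<open>C\<close> is fixed before \<open>t\<close>, so the error vanishes when
    \<open>t\<close> tends to 0.\<close>
  obtain C where C: "\<And>t. 0 \<le> t \<Longrightarrow>
      norm ((id_blinfun + t *\<^sub>R F) o\<^sub>L B o\<^sub>L (id_blinfun + t *\<^sub>R F)) \<le> 1 + 2 * t * f + C * t\<^sup>2"
    unfolding B_def
    by (rule norm_perturbed_two_level_le[OF p(2) _ _ psd_symmetric[OF F] f f0, of "7/9"]) auto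
  have "psd (B - A)"
  proof -
    \<comment> \<open>\<open>31/144 = 7/9 - 9/16\<close>.\<close>
    have "B - A = (31/144) *\<^sub>R (id_blinfun - p)"
      by (rule blinfun_eqI)
        (simp add: A_def B_def two_level_apply blinfun.diff_left blinfun.scaleR_left flip: scaleR_diff_left)
    moreover have "psd (id_blinfun - p)"
    proof -
      have "(id_blinfun - p) o\<^sub>L (id_blinfun - p) = id_blinfun - p"
        by (rule blinfun_eqI) (simp add: blinfun.diff_left blinfun.diff_right orth_proj_idem[OF p(2)])
      then show ?thesis
        using psd_square[OF symmetric_op_diff[OF symmetric_op_id orth_proj_symmetric[OF p(2)]]] by simp
    qed
    ultimately show ?thesis by (simp add: psd_scaleR)
  qed
  then have AB: "le_op A B" using AM BM by (simp add: le_op_iff_psd)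
  \<comment> \<open>For \<open>t^2 X\<close> the Riccati solutions belonging to \<open>A\<close> and
    \<open>B\<close> are \<open>t G\<close> and \<open>t F\<close>; the two norm estimates are
    compared and divided by \<open>2 t\<close>.\<close>
  have ineq: "inner y (G y) \<le> f * (norm y)\<^sup>2 + C / 2 * (norm y)\<^sup>2 * t" if t: "0 < t" for t
  proof -
    let ?X = "(t *\<^sub>R F) o\<^sub>L B o\<^sub>L (t *\<^sub>R F)"
    have tF: "t *\<^sub>R F \<in> M" "psd (t *\<^sub>R F)" and tG: "t *\<^sub>R G \<in> M" "psd (t *\<^sub>R G)"
      using FM F G t by (auto intro: psd_scaleR)
    have "?X \<in> pos_inv M"
    proof (rule conj_pos_inv[OF tF(1) psd_symmetric[OF tF(2)] _ _ BM(1,2) _ B_ge])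
      show "0 < t * (3/4 * \<epsilon>)" using t \<epsilon> by simp
      show "t * (3/4 * \<epsilon>) * (norm x)\<^sup>2 \<le> inner x ((t *\<^sub>R F) x)" for x
        using mult_left_mono[OF F_ge[of x], of t] t by (simp add: blinfun.scaleR_left mult.assoc)
    qed simp
    then have le: "norm (wasserstein_mean A ?X) \<le> norm (wasserstein_mean B ?X)"
      using od AB AM(3) BM(3) unfolding order_determining_def by blast
    have X_eq: "?X = (t *\<^sub>R G) o\<^sub>L A o\<^sub>L (t *\<^sub>R G)"
    proof -
      have "?X = t\<^sup>2 *\<^sub>R X" "(t *\<^sub>R G) o\<^sub>L A o\<^sub>L (t *\<^sub>R G) = t\<^sup>2 *\<^sub>R (G o\<^sub>L A o\<^sub>L G)"
        by (auto intro!: blinfun_eqI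
            simp: X_def blinfun.scaleR_left blinfun.scaleR_right power2_eq_square)
      then show ?thesis by (simp add: G(3))
    qed
    let ?GA = "(id_blinfun + t *\<^sub>R G) o\<^sub>L A o\<^sub>L (id_blinfun + t *\<^sub>R G)"
    have "norm ?GA \<le> 1 + 2 * t * f + C * t\<^sup>2"
      using le wasserstein_mean_eq[OF AM(3) tG, folded X_eq] wasserstein_mean_eq[OF BM(3) tF] C[of t] t
      by simp
    then have "norm ?GA * (norm y)\<^sup>2 \<le> (1 + 2 * t * f + C * t\<^sup>2) * (norm y)\<^sup>2"
      by (rule mult_right_mono) simp
    moreover have "(norm y)\<^sup>2 + 2 * t * inner y (G y) \<le> inner y (?GA y)"
      unfolding A_def
      by (rule inner_perturbed_two_level_ge[OF p(2) _ psd_symmetric[OF G(2)] y]) simp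
    moreover have "inner y (?GA y) \<le> norm ?GA * (norm y)\<^sup>2" by (rule inner_apply_le)
    ultimately have "(norm y)\<^sup>2 + 2 * t * inner y (G y) \<le> (1 + 2 * t * f + C * t\<^sup>2) * (norm y)\<^sup>2"
      by linarith
    then have "(2 * t) * inner y (G y) \<le> (2 * t) * (f * (norm y)\<^sup>2 + C / 2 * (norm y)\<^sup>2 * t)"
      by (simp add: algebra_simps power2_eq_square)
    then show ?thesis using t by (simp add: mult_le_cancel_left_pos)
  qed
  have "((\<lambda>t. f * (norm y)\<^sup>2 + C / 2 * (norm y)\<^sup>2 * t) \<longlongrightarrow> f * (norm y)\<^sup>2 + C / 2 * (norm y)\<^sup>2 * 0) (at_right 0)"
    by (intro tendsto_intros)
  moreover have "\<forall>\<^sub>F t in at_right 0. inner y (G y) \<le> f * (norm y)\<^sup>2 + C / 2 * (norm y)\<^sup>2 * t"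
    unfolding eventually_at_right_field using ineq by (intro exI[of _ 1]) auto
  ultimately have "inner y (G y) \<le> f * (norm y)\<^sup>2 + C / 2 * (norm y)\<^sup>2 * 0"
    by (rule tendsto_lowerbound) simp
  \<comment> \<open>The ratio of 3/4, from \<open>f\<close>, to 4/5 is the final factor
    15/16.\<close>
  moreover have "(4/5) * inner y (m y) \<le> inner y (G y)"
    using G_ge[of y] by (simp add: G0_def blinfun.scaleR_left Kz[OF y])
  ultimately show ?thesis by (simp add: f_def algebra_simps)
qed

text \<open>The corner estimate improves itself: applied with the norm \<mu> of the corner of
  \<open>m\<close>, it gives \<open>\<mu> \<le> (15/16) * \<mu>\<close>, so the corner is zero. This
  annihilates first \<open>m p\<close>, then \<open>h p\<close>, and finally the off-diagonal part
  \<open>h\<close> of \<open>Y\<close>.\<close>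

lemma projections_commute_if_order_determining:
  assumes od: "order_determining M wasserstein_mean"
    and p: "p \<in> M" "orth_proj p" and Y: "Y \<in> M" "symmetric_op Y"
  shows "p o\<^sub>L Y = Y o\<^sub>L p"
proof -
  let ?I = "id_blinfun :: 'h \<Rightarrow>\<^sub>L 'h"
  have pp: "p (p x) = p x" for x by (rule orth_proj_idem[OF p(2)])
  have sp: "inner (p x) y = inner x (p y)" for x y by (rule symmetric_opD[OF orth_proj_symmetric[OF p(2)]])
  define h where "h = (p o\<^sub>L Y o\<^sub>L (?I - p)) + ((?I - p) o\<^sub>L Y o\<^sub>L p)"
  have hx: "h x = p (Y x) + Y (p x) - 2 *\<^sub>R p (Y (p x))" for x
    by (simp add: h_def blinfun.add_left blinfun.diff_left blinfun.diff_right scaleR_2)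
  have hM: "h \<in> M" unfolding h_def by (intro add_mem compose_mem diff_mem id_mem p(1) Y(1))
  have h: "symmetric_op h"
    by (simp add: symmetric_op_def hx inner_add_left inner_add_right inner_diff_left inner_diff_right
        sp symmetric_opD[OF Y(2)])
  have ph: "p (h x) = h (x - p x)" for x
    by (simp add: hx blinfun.add_right blinfun.diff_right blinfun.scaleR_right pp scaleR_2)
  have ph': "p (h x) = h x - h (p x)" for x
    by (simp add: ph blinfun.diff_right)
  obtain m where m: "m \<in> M" "psd m" "m o\<^sub>L m = h o\<^sub>L h"
    and comm: "\<And>C. C o\<^sub>L (h o\<^sub>L h) = (h o\<^sub>L h) o\<^sub>L C \<Longrightarrow> C o\<^sub>L m = m o\<^sub>L C"
    using sqrt_exists[OF compose_mem[OF hM hM] psd_square[OF h]] by metis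
  have hm: "h (m x) = m (h x)" for x
    using comm[of h] by (metis blinfun_apply_blinfun_compose blinfun_compose_assoc)
  \<comment> \<open>The square of an off-diagonal operator is diagonal.\<close>
  have "p o\<^sub>L (h o\<^sub>L h) = (h o\<^sub>L h) o\<^sub>L p"
    by (rule blinfun_eqI) (simp add: ph' blinfun.diff_right)
  then have pm: "p (m x) = m (p x)" for x
    using comm[of p] by (metis blinfun_apply_blinfun_compose)
  define \<mu> where "\<mu> = norm (p o\<^sub>L m o\<^sub>L p)"
  have \<mu>0: "0 \<le> \<mu>" by (simp add: \<mu>_def)
  have \<mu>: "inner y (m y) \<le> \<mu> * (norm y)\<^sup>2" if "p y = y" for y
    using inner_apply_le[of y "p o\<^sub>L m o\<^sub>L p"] that by (simp add: \<mu>_def flip: sp)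
  have corner: "inner y (m y) \<le> (15/16) * \<mu> * (norm y)\<^sup>2" if y: "p y = y" for y
  proof -
    have "((\<lambda>\<epsilon>. (15/16) * (\<mu> + \<epsilon>) * (norm y)\<^sup>2) \<longlongrightarrow> (15/16) * (\<mu> + 0) * (norm y)\<^sup>2) (at_right 0)"
      by (intro tendsto_intros)
    moreover have "\<forall>\<^sub>F \<epsilon> in at_right 0. inner y (m y) \<le> (15/16) * (\<mu> + \<epsilon>) * (norm y)\<^sup>2"
      unfolding eventually_at_right_field
      using off_diagonal_corner_le[OF od p hM h ph m hm pm _ \<mu>0 \<mu> y] by (intro exI[of _ 1]) auto
    ultimately have "inner y (m y) \<le> (15/16) * (\<mu> + 0) * (norm y)\<^sup>2"
      by (rule tendsto_lowerbound) simp
    then show ?thesis by simp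
  qed
  have "\<mu> \<le> (15/16) * \<mu>"
    unfolding \<mu>_def
  proof (rule psd_norm_le, fold \<mu>_def)
    show "psd (p o\<^sub>L m o\<^sub>L p)" by (rule psd_conj[OF m(2) orth_proj_symmetric[OF p(2)]])
    fix x
    have "inner x ((p o\<^sub>L m o\<^sub>L p) x) = inner (p x) (m (p x))" by (simp add: sp)
    also have "\<dots> \<le> (15/16) * \<mu> * (norm (p x))\<^sup>2" by (rule corner) (rule pp)
    also have "\<dots> \<le> (15/16) * \<mu> * (norm x)\<^sup>2"
      using norm_orth_proj_split[OF p(2), of x] \<mu>0 by (intro mult_left_mono) auto
    finally show "inner x ((p o\<^sub>L m o\<^sub>L p) x) \<le> (15/16) * \<mu> * (norm x)\<^sup>2" .
  qed (use \<mu>0 in simp)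
  then have "\<mu> = 0" using \<mu>0 by simp
  then have "p o\<^sub>L m o\<^sub>L p = 0" by (simp add: \<mu>_def)
  then have mp: "m (p x) = 0" for x
    using compose_left_cong[of "p o\<^sub>L m" p 0 x] by (simp add: pm pp)
  have hp: "h (p x) = 0" for x
  proof -
    have "(norm (h (p x)))\<^sup>2 = inner (p x) (h (h (p x)))"
      by (simp add: power2_norm_eq_inner symmetric_opD[OF h])
    also have "h (h (p x)) = m (m (p x))" using compose_left_cong[OF m(3), of "p x"] by simp
    finally show ?thesis by (simp add: mp)
  qed
  have "h x = 0" for x
  proof -
    have "(norm (h x))\<^sup>2 = inner (p (h x)) (h x)" using ph'[of x] by (simp add: hp power2_norm_eq_inner)
    also have "\<dots> = inner (h x) (p (h x))" by (rule inner_commute)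
    also have "\<dots> = inner x (h (p (h x)))" by (rule symmetric_opD[OF h])
    finally show ?thesis by (simp add: hp)
  qed
  then have eq: "p (Y x) + Y (p x) = 2 *\<^sub>R p (Y (p x))" for x using hx[of x] by simp
  show ?thesis
  proof (rule blinfun_eqI)
    fix x
    \<comment> \<open>Multiplying \<open>p Y + Y p = 2 p Y p\<close> by \<open>p\<close> on the left
      and on the right identifies both products with \<open>p Y p\<close>.\<close>
    have "p (Y x) = p (Y (p x))"
      using arg_cong[OF eq[of x], of "blinfun_apply p"]
      by (simp add: blinfun.add_right blinfun.scaleR_right pp scaleR_2)
    moreover have "Y (p x) = p (Y (p x))"
      using eq[of "p x"] by (simp add: pp scaleR_2)
    ultimately show "(p o\<^sub>L Y) x = (Y o\<^sub>L p) x" by simp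
  qed
qed

end

theorem proposition4p2:
  fixes M :: "('h::chilbert_space \<Rightarrow>\<^sub>L 'h) set"
  assumes "von_neumann_algebra M"
  shows "order_determining M wasserstein_mean \<longleftrightarrow> commutative_algebra M"
proof -
  interpret vn_algebra M by unfold_locales (rule assms)
  show ?thesis
    using commutative_if_projections_commute projections_commute_if_order_determining
      order_determining_if_commutative by (auto simp: orth_proj_def)
qed

end
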